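(* The model checking problem for $\mathsf{K}^{\to}_0$ is $\mathsf{P}$-hard (under logspace many-one reductions).
   Context: Modal formulas are built by $\varphi ::= \bot \mid p \mid \varphi\to\varphi \mid \Box\varphi$ over a countable set of variables. A Kripke model is $(U,R,\xi)$ with $U$ finite nonempty, $R$ an arbitrary binary relation on $U$, and $\xi$ assigning to each variable a subset of $U$. Satisfaction: $s\not\models\bot$; $s\models p$ iff $s\in\xi(p)$; $s\models\varphi\to\psi$ iff $s\not\models\varphi$ or $s\models\psi$; $s\models\Box\varphi$ iff $t\models\varphi$ for all $t$ with $(s,t)\in R$. $\mathsf{K}^{\to}_0$ is the set of strictly implicational variable-free formulas, i.e. those generated by $\varphi ::= \bot \mid \Box(\varphi\to\varphi)$. The model checking problem for $\mathsf{K}^{\to}_0$: given such a formula $\varphi$, a finite Kripke model $\mathfrak{M}$ (with arbitrary relation, given by adjacency matrix) and a state $s$, decide whether $\mathfrak{M},s\models\varphi$. *)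

theory Defs
  imports
    Complex_Main
    "HOL-Computational_Algebra.Polynomial"
    "HOL-Library.Landau_Symbols"
begin

section \<open>Modal formulas and Kripke models\<close>

datatype form = Bot | Var nat | Imp form form | Box form

inductive_set strict_imp_varfree :: "form set" where
  Bot: "Bot \<in> strict_imp_varfree"
| Box_Imp: "\<lbrakk>\<phi> \<in> strict_imp_varfree; \<psi> \<in> strict_imp_varfree\<rbrakk> \<Longrightarrow> Box (Imp \<phi> \<psi>) \<in> strict_imp_varfree"

record 'w kripke =
  worlds :: "'w set"
  rel :: "('w \<times> 'w) set"
  val :: "nat \<Rightarrow> 'w set"

definition kripke_model :: "'w kripke \<Rightarrow> bool" where
  "kripke_model M \<longleftrightarrow>
     finite (worlds M) \<and> worlds M \<noteq> {} \<and>
     rel M \<subseteq> worlds M \<times> worlds M \<and> (\<forall>p. val M p \<subseteq> worlds M)"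

fun sat :: "'w kripke \<Rightarrow> 'w \<Rightarrow> form \<Rightarrow> bool" where
  "sat M s Bot \<longleftrightarrow> False"
| "sat M s (Var p) \<longleftrightarrow> s \<in> val M p"
| "sat M s (Imp \<phi> \<psi>) \<longleftrightarrow> \<not> sat M s \<phi> \<or> sat M s \<psi>"
| "sat M s (Box \<phi>) \<longleftrightarrow> (\<forall>t. (s, t) \<in> rel M \<longrightarrow> sat M t \<phi>)"


section \<open>Instances of model checking as bit strings\<close>

definition unary :: "nat \<Rightarrow> bool list" where
  "unary n = replicate n True @ [False]"

text \<open>
  Formulas are written out as strings (trees, no sharing of subformulas) in prefix notation;
  every constructor has a two-bit tag.
\<close>

fun enc_form :: "form \<Rightarrow> bool list" where
  "enc_form Bot = [False, False]"
| "enc_form (Var p) = [False, True] @ unary p"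
| "enc_form (Imp \<phi> \<psi>) = [True, False] @ enc_form \<phi> @ enc_form \<psi>"
| "enc_form (Box \<phi>) = [True, True] @ enc_form \<phi>"

text \<open>The least bound on the indices of the variables occurring in a formula.\<close>

fun var_bound :: "form \<Rightarrow> nat" where
  "var_bound Bot = 0"
| "var_bound (Var p) = Suc p"
| "var_bound (Imp \<phi> \<psi>) = max (var_bound \<phi>) (var_bound \<psi>)"
| "var_bound (Box \<phi>) = var_bound \<phi>"

definition enc_set :: "nat \<Rightarrow> nat set \<Rightarrow> bool list" where
  "enc_set n A = map (\<lambda>i. i \<in> A) [0..<n]"

text \<open>
  An instance is a formula, a model with set of worlds \<open>{..<n}\<close> and a world. The string
  lists the formula, \<open>n\<close> in unary, the adjacency matrix row by row, the characteristic
  vectors of the values of the variables below \<open>var_bound \<phi>\<close>, and the world in unary.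
  Of the valuation, an infinite object, only the part relevant for the formula is listed, which
  is empty for a variable-free formula.
\<close>

definition enc_instance :: "form \<Rightarrow> nat kripke \<Rightarrow> nat \<Rightarrow> bool list" where
  "enc_instance \<phi> M s =
    (let n = card (worlds M) in
       enc_form \<phi> @ unary n
       @ concat (map (\<lambda>i. enc_set n (rel M `` {i})) [0..<n])
       @ concat (map (\<lambda>p. enc_set n (val M p)) [0..<var_bound \<phi>])
       @ unary s)"

definition model_checking :: "form set \<Rightarrow> bool list set" where
  "model_checking F =
    {enc_instance \<phi> M s | \<phi> M s.
       \<phi> \<in> F \<and> kripke_model M \<and> (\<exists>n. worlds M = {..<n}) \<and> s \<in> worlds M \<and> sat M s \<phi>}"

text \<open>The encoding loses nothing, so that the language represents the decision problem.\<close>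

lemma unary_append_inject: "unary m @ xs = unary n @ ys \<longleftrightarrow> m = n \<and> xs = ys"
proof (induction m arbitrary: n)
  case 0
  show ?case by (cases n) (auto simp: unary_def)
next
  case (Suc m)
  then show ?case by (cases n) (auto simp: unary_def)
qed

lemma enc_form_append_inject:
  "enc_form \<phi> @ xs = enc_form \<psi> @ ys \<longleftrightarrow> \<phi> = \<psi> \<and> xs = ys"
proof (induction \<phi> arbitrary: \<psi> xs ys)
  case Bot
  show ?case by (cases \<psi>) auto
next
  case (Var p)
  show ?case by (cases \<psi>) (auto simp: unary_append_inject)
next
  case (Imp \<phi>1 \<phi>2)
  then show ?case by (cases \<psi>) auto
next
  case (Box \<phi>)
  then show ?case by (cases \<psi>) auto
qed

lemma enc_set_inject: "enc_set n A = enc_set n B \<longleftrightarrow> (\<forall>i<n. i \<in> A \<longleftrightarrow> i \<in> B)"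
  by (auto simp: enc_set_def)

lemma length_enc_set [simp]: "length (enc_set n A) = n"
  by (simp add: enc_set_def)

lemma enc_sets_append_inject:
  "concat (map (\<lambda>i. enc_set n (A i)) is) @ xs = concat (map (\<lambda>i. enc_set n (B i)) is) @ ys
   \<longleftrightarrow> (\<forall>i\<in>set is. enc_set n (A i) = enc_set n (B i)) \<and> xs = ys"
  by (induction "is") auto

lemma enc_instance_inject:
  assumes M: "kripke_model M" "worlds M = {..<m}"
    and N: "kripke_model N" "worlds N = {..<n}"
    and eq: "enc_instance \<phi> M s = enc_instance \<psi> N t"
  shows "\<phi> = \<psi> \<and> s = t \<and> worlds M = worlds N \<and> rel M = rel N \<and>
    (\<forall>p<var_bound \<phi>. val M p = val N p)"
proof -
  from eq M(2) N(2) have 1: "\<phi> = \<psi>" "m = n"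
    by (simp_all add: enc_instance_def Let_def enc_form_append_inject unary_append_inject)
  have un: "unary s = unary t \<longleftrightarrow> s = t"
    using unary_append_inject[of s "[]" t "[]"] by simp
  from eq M(2) N(2) 1 un
  have 2: "s = t" "\<forall>i<n. \<forall>j<n. (i, j) \<in> rel M \<longleftrightarrow> (i, j) \<in> rel N"
    "\<forall>p<var_bound \<phi>. \<forall>i<n. i \<in> val M p \<longleftrightarrow> i \<in> val N p"
    by (simp_all add: enc_instance_def Let_def enc_form_append_inject unary_append_inject
        enc_sets_append_inject enc_set_inject)
  have "rel M = rel N"
  proof (intro set_eqI)
    fix e :: "nat \<times> nat"
    obtain i j where e: "e = (i, j)" by fastforce
    have "rel M \<subseteq> {..<n} \<times> {..<n}" "rel N \<subseteq> {..<n} \<times> {..<n}"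
      using M N 1 by (simp_all add: kripke_model_def)
    then show "e \<in> rel M \<longleftrightarrow> e \<in> rel N"
      using 2(2) unfolding e by blast
  qed
  moreover have "val M p = val N p" if "p < var_bound \<phi>" for p
  proof -
    have "val M p \<subseteq> {..<n}" "val N p \<subseteq> {..<n}"
      using M N 1 by (simp_all add: kripke_model_def)
    then show ?thesis using 2(3) that by blast
  qed
  ultimately show ?thesis using 1 2 M N by simp
qed


section \<open>Polynomial time\<close>

text \<open>
  Deterministic Turing machines with a single tape that is infinite to the right;
  a move to the left on the leftmost cell has no effect (truncated subtraction).
  Inputs are bit strings.
\<close>

datatype symbol = Blank | Bit bool | Aux nat

datatype dir = Leftward | Stay | Rightward

fun move :: "dir \<Rightarrow> nat \<Rightarrow> nat" where
  "move Leftward i = i - 1"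
| "move Stay i = i"
| "move Rightward i = Suc i"

record tm =
  tm_states :: "nat set"
  tm_alphabet :: "symbol set"
  tm_start :: nat
  tm_accept :: nat
  tm_reject :: nat
  tm_delta :: "nat \<Rightarrow> symbol \<Rightarrow> nat \<times> symbol \<times> dir"

definition turing_machine :: "tm \<Rightarrow> bool" where
  "turing_machine M \<longleftrightarrow>
     finite (tm_states M) \<and> finite (tm_alphabet M) \<and>
     {Blank, Bit False, Bit True} \<subseteq> tm_alphabet M \<and>
     {tm_start M, tm_accept M, tm_reject M} \<subseteq> tm_states M \<and>
     tm_accept M \<noteq> tm_reject M \<and>
     (\<forall>q \<in> tm_states M - {tm_accept M, tm_reject M}. \<forall>a \<in> tm_alphabet M.
        tm_delta M q a \<in> tm_states M \<times> tm_alphabet M \<times> UNIV)"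

text \<open>Configurations consist of the state, the head position and the tape contents.\<close>

type_synonym tm_config = "nat \<times> nat \<times> (nat \<Rightarrow> symbol)"

definition tm_init :: "tm \<Rightarrow> bool list \<Rightarrow> tm_config" where
  "tm_init M x = (tm_start M, 0, \<lambda>i. if i < length x then Bit (x ! i) else Blank)"

definition tm_step :: "tm \<Rightarrow> tm_config \<Rightarrow> tm_config" where
  "tm_step M = (\<lambda>(q, h, tape).
     if q = tm_accept M \<or> q = tm_reject M then (q, h, tape)
     else case tm_delta M q (tape h) of (q', a, d) \<Rightarrow> (q', move d h, tape(h := a)))"

definition tm_state_after :: "tm \<Rightarrow> bool list \<Rightarrow> nat \<Rightarrow> nat" where
  "tm_state_after M x t = fst ((tm_step M ^^ t) (tm_init M x))"

definition tm_decides_in_time :: "tm \<Rightarrow> bool list set \<Rightarrow> (nat \<Rightarrow> nat) \<Rightarrow> bool" where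
  "tm_decides_in_time M A T \<longleftrightarrow>
     (\<forall>x. \<exists>t \<le> T (length x).
        tm_state_after M x t = (if x \<in> A then tm_accept M else tm_reject M))"

definition PTIME :: "bool list set set" where
  "PTIME = {A. \<exists>M (p :: nat poly). turing_machine M \<and> tm_decides_in_time M A (poly p)}"


section \<open>Logarithmic space reductions\<close>

text \<open>
  Deterministic transducers with a two-way read-only input tape, finitely many work tapes and a
  write-only output tape. The input \<open>x\<close> occupies positions \<open>1, \<dots>, length x\<close>
  and is delimited by end markers at positions \<open>0\<close> and \<open>Suc (length x)\<close>,
  beyond which the input head cannot move. In each step at most one bit is appended to the
  output. The output tape can neither be read nor revised, and it is not counted as space.
\<close>

datatype in_symbol = LeftEnd | InBit bool | RightEnd

record transducer =
  tr_states :: "nat set"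
  tr_alphabet :: "symbol set"
  tr_tapes :: nat
  tr_start :: nat
  tr_halt :: nat
  tr_delta :: "nat \<Rightarrow> in_symbol \<Rightarrow> symbol list \<Rightarrow> nat \<times> dir \<times> (symbol \<times> dir) list \<times> bool option"

definition transducer_wf :: "transducer \<Rightarrow> bool" where
  "transducer_wf M \<longleftrightarrow>
     finite (tr_states M) \<and> finite (tr_alphabet M) \<and> Blank \<in> tr_alphabet M \<and>
     {tr_start M, tr_halt M} \<subseteq> tr_states M \<and>
     (\<forall>q \<in> tr_states M - {tr_halt M}. \<forall>a. \<forall>ws \<in> lists (tr_alphabet M).
        length ws = tr_tapes M \<longrightarrow>
        (case tr_delta M q a ws of (q', d, acts, out) \<Rightarrow>
           q' \<in> tr_states M \<and> length acts = tr_tapes M \<and> fst ` set acts \<subseteq> tr_alphabet M))"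

record tr_config =
  cf_state :: nat
  cf_in_head :: nat
  cf_work :: "(nat \<times> (nat \<Rightarrow> symbol)) list"  \<comment> \<open>head position and contents of each work tape\<close>
  cf_output :: "bool list"

definition in_read :: "bool list \<Rightarrow> nat \<Rightarrow> in_symbol" where
  "in_read x i =
     (if i = 0 then LeftEnd else if i \<le> length x then InBit (x ! (i - 1)) else RightEnd)"

definition tr_init :: "transducer \<Rightarrow> tr_config" where
  "tr_init M =
     \<lparr>cf_state = tr_start M, cf_in_head = 0,
      cf_work = replicate (tr_tapes M) (0, \<lambda>_. Blank), cf_output = []\<rparr>"

definition tr_step :: "transducer \<Rightarrow> bool list \<Rightarrow> tr_config \<Rightarrow> tr_config" where
  "tr_step M x c =
     (if cf_state c = tr_halt M then c
      else case tr_delta M (cf_state c) (in_read x (cf_in_head c))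
                  (map (\<lambda>(h, tape). tape h) (cf_work c)) of
        (q', d, acts, out) \<Rightarrow>
          \<lparr>cf_state = q',
           cf_in_head = min (move d (cf_in_head c)) (Suc (length x)),
           cf_work = map2 (\<lambda>(h, tape) (a, e). (move e h, tape(h := a))) (cf_work c) acts,
           cf_output = cf_output c @ (case out of None \<Rightarrow> [] | Some b \<Rightarrow> [b])\<rparr>)"

definition tr_run :: "transducer \<Rightarrow> bool list \<Rightarrow> nat \<Rightarrow> tr_config" where
  "tr_run M x t = (tr_step M x ^^ t) (tr_init M)"

definition tr_computes :: "transducer \<Rightarrow> (bool list \<Rightarrow> bool list) \<Rightarrow> bool" where
  "tr_computes M f \<longleftrightarrow>
     (\<forall>x. \<exists>t. cf_state (tr_run M x t) = tr_halt M \<and> cf_output (tr_run M x t) = f x)"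

text \<open>All work heads stay on the first \<open>S (length x)\<close> cells of their tapes.\<close>

definition tr_runs_in_space :: "transducer \<Rightarrow> (nat \<Rightarrow> nat) \<Rightarrow> bool" where
  "tr_runs_in_space M S \<longleftrightarrow>
     (\<forall>x t. \<forall>(h, tape) \<in> set (cf_work (tr_run M x t)). h < S (length x))"

definition logspace_computable :: "(bool list \<Rightarrow> bool list) \<Rightarrow> bool" where
  "logspace_computable f \<longleftrightarrow>
     (\<exists>M S. transducer_wf M \<and> tr_computes M f \<and> tr_runs_in_space M S \<and>
        (\<lambda>n. real (S n)) \<in> O(\<lambda>n. ln (real n)))"

definition logspace_reducible :: "bool list set \<Rightarrow> bool list set \<Rightarrow> bool" where
  "logspace_reducible A B \<longleftrightarrow> (\<exists>f. logspace_computable f \<and> (\<forall>x. x \<in> A \<longleftrightarrow> f x \<in> B))"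

definition P_hard :: "bool list set \<Rightarrow> bool" where
  "P_hard B \<longleftrightarrow> (\<forall>A \<in> PTIME. logspace_reducible A B)"

end

theory Submission
  imports Defs
begin

text \<open>
  Let \<open>\<phi>\<^sub>0 = \<bottom>\<close> and \<open>\<phi>\<^sub>m\<^sub>+\<^sub>1 = \<box>(\<phi>\<^sub>m \<rightarrow> \<bottom>)\<close>. A world satisfies \<open>\<phi>\<^sub>m\<^sub>+\<^sub>1\<close> iff no successor satisfies
  \<open>\<phi>\<^sub>m\<close>, so on an acyclic model \<open>\<phi>\<^sub>m\<close> computes, for \<open>m\<close> above the height, the circuit whose gates are
  the worlds, each the NOR of its successors. The tableau of a polynomial time computation is such a
  circuit: the worlds are triples (time, cell, gate) and an edge depends only on comparisons of
  the coordinates up to an offset of one and, at time 0, on an input bit. A transducer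
  holding the coordinates in binary counters can therefore print the adjacency matrix. Such transducers
  are obtained by compiling structured counter programs, whose behaviour is proved with Hoare
  triples.
\<close>

section \<open>Binary counters on work tapes\<close>

text \<open>The operator \<open>Box (Imp \<phi> Bot)\<close> has one proper argument, so
  \<open>nor m\<close> is a chain of linear size although formulas are written out as trees; the
  sharing that a circuit needs is provided by the model, where a world may have many predecessors.
  The value of \<open>nor m\<close> at a world is final once \<open>m\<close> exceeds its rank, so
  gates of different depths need no padding into layers. Each time step of the tableau occupies four
  ranks, hence the formula \<open>nor (4 * D)\<close>. The side \<open>D\<close> bounds time and
  space alike, since the head moves at most one cell per step. It has the form c * (n + 1)^d because
  increments and loops compute such a number by repeated multiplication. The delicate half is the
  transducer: logarithmic space concerns every configuration of the run, including those inside an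
  instruction, so the space bound is carried along with each step instead of being added
  afterwards.\<close>

fun binc :: "bool list \<Rightarrow> bool list" where
  "binc [] = [True]"
| "binc (False # bs) = True # bs"
| "binc (True # bs) = False # binc bs"

definition bits :: "nat \<Rightarrow> bool list" where
  "bits n = (binc ^^ n) []"

fun bval :: "bool list \<Rightarrow> nat" where
  "bval [] = 0"
| "bval (b # bs) = of_bool b + 2 * bval bs"

lemma bval_binc [simp]: "bval (binc bs) = Suc (bval bs)"
  by (induction bs rule: binc.induct) auto

lemma bits_0 [simp]: "bits 0 = []"
  by (simp add: bits_def)

lemma bits_Suc: "bits (Suc n) = binc (bits n)"
  by (simp add: bits_def)

lemma bval_bits [simp]: "bval (bits n) = n"
  by (induction n) (simp_all add: bits_Suc)

lemma bits_inject [simp]: "bits m = bits n \<longleftrightarrow> m = n"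
  by (metis bval_bits)

lemma length_binc: "length bs \<le> length (binc bs)"
  by (induction bs rule: binc.induct) auto

lemma length_bits_mono: "m \<le> n \<Longrightarrow> length (bits m) \<le> length (bits n)"
  by (induction rule: dec_induct) (auto simp: bits_Suc intro: order_trans length_binc)

lemma binc_nonempty [simp]: "binc bs \<noteq> []"
  by (cases bs rule: binc.cases) auto

text \<open>Overflow appends a new top bit \<open>True\<close>; without overflow the old top bit
  stays.\<close>

lemma last_binc: "bs = [] \<or> last bs \<Longrightarrow> last (binc bs)"
  by (induction bs rule: binc.induct) (auto split: if_splits)

lemma bval_ge: "bs \<noteq> [] \<Longrightarrow> last bs \<Longrightarrow> 2 ^ (length bs - 1) \<le> bval bs"
proof (induction bs)
  case (Cons b bs)
  show ?case
  proof (cases bs)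
    case Nil
    then show ?thesis using Cons.prems by simp
  next
    case (Cons c cs)
    then have "2 ^ (length bs - 1) \<le> bval bs" "2 ^ length bs = 2 * (2::nat) ^ (length bs - 1)"
      using Cons.IH Cons.prems by simp_all
    then show ?thesis by simp
  qed
qed simp

lemma last_bits: "0 < n \<Longrightarrow> last (bits n)"
proof (induction n)
  case (Suc n)
  then show ?case by (cases n) (simp_all add: bits_Suc last_binc)
qed simp

text \<open>The set top bit alone contributes this power of two; hence counters bounded by a
  polynomial occupy logarithmically many cells.\<close>

lemma length_bits_le:
  assumes "0 < n"
  shows "2 ^ (length (bits n) - 1) \<le> n"
proof -
  have "bits n \<noteq> []"
    using assms by (cases n) (simp_all add: bits_Suc)
  then show ?thesis
    using bval_ge[of "bits n"] last_bits[OF assms] by simp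
qed

text \<open>
  Least significant bit first. Cell 0 stays blank: it marks the left end, where the head rests
  between two instructions.
\<close>

definition tape_of :: "bool list \<Rightarrow> nat \<Rightarrow> symbol" where
  "tape_of bs i = (if 0 < i \<and> i \<le> length bs then Bit (bs ! (i - 1)) else Blank)"

lemma tape_of_0 [simp]: "tape_of bs 0 = Blank"
  by (simp add: tape_of_def)

lemma tape_of_Nil: "tape_of [] = (\<lambda>_. Blank)"
  by (auto simp: tape_of_def)

lemma tape_of_append [simp]:
  "tape_of (pre @ bs) (Suc (length pre)) = (case bs of [] \<Rightarrow> Blank | b # _ \<Rightarrow> Bit b)"
  by (auto simp: tape_of_def nth_append split: list.split)

lemma tape_of_upd_snoc: "(tape_of pre)(Suc (length pre) := Bit b) = tape_of (pre @ [b])"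
  by (rule ext) (auto simp: tape_of_def nth_append)

lemma tape_of_upd:
  "(tape_of (pre @ a # bs))(Suc (length pre) := Bit b) = tape_of (pre @ b # bs)"
  by (rule ext) (auto simp: tape_of_def nth_append nth_Cons split: nat.split)

lemma tape_of_upd_Nil: "(tape_of bs)(0 := Blank) = tape_of bs"
  by (metis fun_upd_triv tape_of_0)

lemma tape_of_Suc: "h < length bs \<Longrightarrow> tape_of bs (Suc h) = Bit (bs ! h)"
  by (simp add: tape_of_def)

lemma tape_of_erase: "h < length bs \<Longrightarrow> (tape_of (take (Suc h) bs))(Suc h := Blank) = tape_of (take h bs)"
  by (rule ext) (auto simp: tape_of_def)

section \<open>Counter instructions and the transducer that executes them\<close>

datatype test = Eq nat nat | In in_symbol

text \<open>Each of these needs at most one sweep of the work heads to the right and one back.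
  Copies, predecessors and products are obtained from them by loops.\<close>

datatype instr = INC nat | ZERO nat | OUT bool | MOV dir | TEST test nat | JMP nat

text \<open>
  Phase 0 starts the instruction at \<open>pc\<close>, phase 1 scans the counters to the right, and the
  later phases bring the heads back; for an equality test, phases 2 and 3 remember the outcome
  (equal and different).
\<close>

definition state :: "nat \<Rightarrow> nat \<Rightarrow> nat" where
  "state pc m = 4 * pc + m"

lemma state_div_mod [simp]: "m < 4 \<Longrightarrow> state pc m div 4 = pc" "m < 4 \<Longrightarrow> state pc m mod 4 = m"
  by (simp_all add: state_def)

text \<open>The map lists only the tapes that a step touches. Jump targets are clipped at
  \<open>length P\<close>, so every list of instructions, even an ill-formed one, stays within a
  finite set of states. The phases that return to the left recognise cell 0 by its blank.\<close>

definition micro :: "instr list \<Rightarrow> nat \<Rightarrow> in_symbol \<Rightarrow> (nat \<Rightarrow> symbol) \<Rightarrow>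
    nat \<times> dir \<times> (nat \<rightharpoonup> symbol \<times> dir) \<times> bool option" where
  "micro P q a R =
    (let pc = q div 4; m = q mod 4; goto = (\<lambda>l. state (min l (length P)) 0) in
     if length P \<le> pc then (goto pc, Stay, Map.empty, None)
     else case P ! pc of
       OUT b \<Rightarrow> (goto (Suc pc), Stay, Map.empty, Some b)
     | MOV d \<Rightarrow> (goto (Suc pc), d, Map.empty, None)
     | JMP l \<Rightarrow> (goto l, Stay, Map.empty, None)
     | INC v \<Rightarrow>
         (if m = 0 then (state pc 1, Stay, [v \<mapsto> (R v, Rightward)], None)
          else if m = 1 then
            (if R v = Bit True then (state pc 1, Stay, [v \<mapsto> (Bit False, Rightward)], None)
             else (state pc 2, Stay, [v \<mapsto> (Bit True, Leftward)], None))
          else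
            (if R v = Blank then (goto (Suc pc), Stay, Map.empty, None)
             else (state pc 2, Stay, [v \<mapsto> (R v, Leftward)], None)))
     | ZERO v \<Rightarrow>
         (if m = 0 then (state pc 1, Stay, [v \<mapsto> (R v, Rightward)], None)
          else if m = 1 then
            (if R v = Blank then (state pc 2, Stay, [v \<mapsto> (Blank, Leftward)], None)
             else (state pc 1, Stay, [v \<mapsto> (R v, Rightward)], None))
          else
            (if R v = Blank then (goto (Suc pc), Stay, Map.empty, None)
             else (state pc 2, Stay, [v \<mapsto> (Blank, Leftward)], None)))
     | TEST (In s) l \<Rightarrow> (goto (if a = s then l else Suc pc), Stay, Map.empty, None)
     | TEST (Eq u v) l \<Rightarrow>
         (if m = 0 then (state pc 1, Stay, [u \<mapsto> (R u, Rightward), v \<mapsto> (R v, Rightward)], None)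
          else if m = 1 then
            (if R u \<noteq> R v then (state pc 3, Stay, [u \<mapsto> (R u, Leftward), v \<mapsto> (R v, Leftward)], None)
             else if R u = Blank then (state pc 2, Stay, [u \<mapsto> (R u, Leftward), v \<mapsto> (R v, Leftward)], None)
             else (state pc 1, Stay, [u \<mapsto> (R u, Rightward), v \<mapsto> (R v, Rightward)], None))
          else
            (if R u = Blank then (goto (if m = 2 then l else Suc pc), Stay, Map.empty, None)
             else (state pc m, Stay, [u \<mapsto> (R u, Leftward), v \<mapsto> (R v, Leftward)], None))))"

text \<open>A tape that \<open>micro\<close> leaves out rewrites its scanned symbol and stays.
  Running off the end of the program is halting.\<close>

definition counter_transducer :: "nat \<Rightarrow> instr list \<Rightarrow> transducer" where
  "counter_transducer k P =
    \<lparr>tr_states = {..<4 * Suc (length P)}, tr_alphabet = {Blank, Bit False, Bit True},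
     tr_tapes = k, tr_start = 0, tr_halt = state (length P) 0,
     tr_delta = \<lambda>q a ws. case micro P q a ((!) ws) of (q', d, F, out) \<Rightarrow>
       (q', d, map (\<lambda>v. case F v of None \<Rightarrow> (ws ! v, Stay) | Some act \<Rightarrow> act) [0..<k], out)\<rparr>"

lemma micro_state:
  assumes "micro P q a R = (q', d, F, out)" 
  shows "q' < 4 * Suc (length P)"
proof (cases "length P \<le> q div 4")
  case True
  then show ?thesis using assms by (auto simp: micro_def Let_def state_def)
next
  case False
  then have "4 * (q div 4) + 3 < 4 * length P" by linarith
  with False show ?thesis using assms
    by (auto simp: micro_def Let_def state_def split: instr.splits test.splits if_splits)
qed

lemma micro_symbols:
  assumes "micro P q a R = (q', d, F, out)" "F v = Some (s, e)"
  shows "s = R v \<or> s \<in> {Blank, Bit False, Bit True}"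
  using assms
  by (auto simp: micro_def Let_def split: instr.splits test.splits if_splits)

lemma counter_transducer_wf: "transducer_wf (counter_transducer k P)"
proof -
  have "q' < 4 * Suc (length P)" "fst ` set (map (\<lambda>v. case F v of None \<Rightarrow> (ws ! v, Stay) | Some act \<Rightarrow> act) [0..<k]) \<subseteq> {Blank, Bit False, Bit True}"
    if m: "micro P q a ((!) ws) = (q', d, F, out)" and ws: "ws \<in> lists {Blank, Bit False, Bit True}" "length ws = k"
    for q a ws q' d F out
  proof -
    show "q' < 4 * Suc (length P)" using m by (rule micro_state)
    have "ws ! v \<in> {Blank, Bit False, Bit True}" if "v < k" for v
      using ws that by (metis in_lists_conv_set nth_mem)
    then show "fst ` set (map (\<lambda>v. case F v of None \<Rightarrow> (ws ! v, Stay) | Some act \<Rightarrow> act) [0..<k]) \<subseteq> {Blank, Bit False, Bit True}"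
      using micro_symbols[OF m] by (auto split: option.split) metis+
  qed
  then show ?thesis
    by (auto simp: transducer_wf_def counter_transducer_def state_def split: prod.split)
qed

section \<open>Runs of single instructions within the space bound\<close>

locale counter_space =
  fixes k :: nat and x :: "bool list" and B :: nat
begin

text \<open>One extra cell is the blank marker at 0, the other the blank behind the top bit, on
  which a sweep to the right ends.\<close>

abbreviation space :: nat where
  "space \<equiv> length (bits B) + 2"

definition mk :: "nat \<Rightarrow> nat \<Rightarrow> (nat \<Rightarrow> nat \<times> (nat \<Rightarrow> symbol)) \<Rightarrow> bool list \<Rightarrow> tr_config" where
  "mk q i W out = \<lparr>cf_state = q, cf_in_head = i, cf_work = map W [0..<k], cf_output = out\<rparr>"

definition heads_ok :: "tr_config \<Rightarrow> bool" where
  "heads_ok c \<longleftrightarrow> (\<forall>(h, tape) \<in> set (cf_work c). h < space)"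

definition reach :: "instr list \<Rightarrow> tr_config \<Rightarrow> tr_config \<Rightarrow> bool" where
  "reach P = (\<lambda>c c'. c' = tr_step (counter_transducer k P) x c \<and> heads_ok c')\<^sup>*\<^sup>*"

lemma reach_refl [simp, intro]: "reach P c c"
  by (simp add: reach_def)

lemma reach_trans [trans]: "reach P c d \<Longrightarrow> reach P d e \<Longrightarrow> reach P c e"
  by (simp add: reach_def)

lemma reach_imp_run:
  assumes "reach P c c'" "heads_ok c"
  shows "\<exists>t. (tr_step (counter_transducer k P) x ^^ t) c = c' \<and>
    (\<forall>s\<le>t. heads_ok ((tr_step (counter_transducer k P) x ^^ s) c))"
  using assms unfolding reach_def
proof (induction rule: rtranclp_induct)
  case base
  then show ?case by (intro exI[of _ 0]) simp
next
  case (step d e)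
  then obtain t where t: "(tr_step (counter_transducer k P) x ^^ t) c = d"
    "\<forall>s\<le>t. heads_ok ((tr_step (counter_transducer k P) x ^^ s) c)" by blast
  then have "(tr_step (counter_transducer k P) x ^^ Suc t) c = e" using step by simp
  moreover from this have "\<forall>s\<le>Suc t. heads_ok ((tr_step (counter_transducer k P) x ^^ s) c)"
    using t step by (metis le_Suc_eq)
  ultimately show ?case by blast
qed

text \<open>The instruction lemmas below reduce to this rule: once the tape updates \<open>F\<close>
  are supplied, only \<open>micro\<close> remains to be evaluated, and the list of tapes is handled
  as a function \<open>W\<close> of the counter.\<close>

lemma reach_step:
  assumes "q div 4 < length P" "i \<le> Suc (length x)"
    and micro: "micro P q (in_read x i) ((!) (map (\<lambda>v. snd (W v) (fst (W v))) [0..<k])) = (q', d, F, out)"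
    and i': "i' = min (move d i) (Suc (length x))"
    and os': "os' = os @ (case out of None \<Rightarrow> [] | Some b \<Rightarrow> [b])"
    and W': "\<And>v. v < k \<Longrightarrow> W' v = (case F v of None \<Rightarrow> W v
        | Some (s, e) \<Rightarrow> (move e (fst (W v)), (snd (W v))(fst (W v) := s)))"
    and ok: "\<And>v. v < k \<Longrightarrow> fst (W' v) < space"
  shows "reach P (mk q i W os) (mk q' i' W' os')"
proof -
  have "q \<noteq> state (length P) 0" using assms(1) by auto
  moreover have "map2 (\<lambda>(h, tape) (a, e). (move e h, tape(h := a))) (map W [0..<k])
      (map (\<lambda>v. case F v of None \<Rightarrow> (map (\<lambda>v. snd (W v) (fst (W v))) [0..<k] ! v, Stay) | Some act \<Rightarrow> act) [0..<k])
    = map W' [0..<k]"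
    by (rule nth_equalityI) (auto simp: W' split_beta split: option.split)
  moreover have "map (\<lambda>(h, tape). tape h) (map W [0..<k]) = map (\<lambda>v. snd (W v) (fst (W v))) [0..<k]"
    by (simp add: split_beta)
  ultimately have "tr_step (counter_transducer k P) x (mk q i W os) =
    mk q' i' W' os'"
    using micro i' os'
    by (simp add: tr_step_def mk_def counter_transducer_def del: map_map)
  moreover have "heads_ok (mk q' i' W' os')"
    using ok by (auto simp: heads_ok_def mk_def) (metis fst_conv)
  ultimately show ?thesis
    unfolding reach_def by (metis (mono_tags, lifting) r_into_rtranclp)
qed

definition rep :: "(nat \<Rightarrow> nat) \<Rightarrow> nat \<Rightarrow> nat \<times> (nat \<Rightarrow> symbol)" where
  "rep \<sigma> v = (0, tape_of (bits (\<sigma> v)))"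

definition conf :: "nat \<Rightarrow> (nat \<Rightarrow> nat) \<Rightarrow> nat \<Rightarrow> bool list \<Rightarrow> tr_config" where
  "conf pc \<sigma> i out = mk (state pc 0) i (rep \<sigma>) out"

definition in_bounds :: "(nat \<Rightarrow> nat) \<Rightarrow> nat \<Rightarrow> bool" where
  "in_bounds \<sigma> i \<longleftrightarrow> (\<forall>v<k. \<sigma> v \<le> B) \<and> i \<le> Suc (length x)"

lemma fst_rep [simp]: "fst (rep \<sigma> v) = 0"
  by (simp add: rep_def)

lemma rep_upd: "(rep \<sigma>)(v := (0, tape_of (bits n))) = rep (\<sigma>(v := n))"
  by (auto simp: rep_def)

lemma rep_triv: "(rep \<sigma>)(u := (0, tape_of (bits (\<sigma> u))), v := (0, tape_of (bits (\<sigma> v)))) = rep \<sigma>"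
  by (auto simp: rep_def)

lemma reach_OUT:
  assumes "pc < length P" "P ! pc = OUT b" "in_bounds \<sigma> i"
  shows "reach P (conf pc \<sigma> i os) (conf (Suc pc) \<sigma> i (os @ [b]))"
  unfolding conf_def
  by (rule reach_step[where F = Map.empty and d = Stay and out = "Some b"])
     (use assms in \<open>auto simp: micro_def Let_def in_bounds_def\<close>)

lemma reach_MOV:
  assumes "pc < length P" "P ! pc = MOV d" "in_bounds \<sigma> i"
  shows "reach P (conf pc \<sigma> i os) (conf (Suc pc) \<sigma> (min (move d i) (Suc (length x))) os)"
  unfolding conf_def
  by (rule reach_step[where F = Map.empty and d = d and out = None])
     (use assms in \<open>auto simp: micro_def Let_def in_bounds_def\<close>)

lemma reach_JMP:
  assumes "pc < length P" "P ! pc = JMP l" "l \<le> length P" "in_bounds \<sigma> i"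
  shows "reach P (conf pc \<sigma> i os) (conf l \<sigma> i os)"
  unfolding conf_def
  by (rule reach_step[where F = Map.empty and d = Stay and out = None])
     (use assms in \<open>auto simp: micro_def Let_def in_bounds_def\<close>)

lemma reach_TEST_In:
  assumes "pc < length P" "P ! pc = TEST (In s) l" "l \<le> length P" "in_bounds \<sigma> i"
  shows "reach P (conf pc \<sigma> i os) (conf (if in_read x i = s then l else Suc pc) \<sigma> i os)"
  unfolding conf_def
  by (rule reach_step[where F = Map.empty and d = Stay and out = None])
     (use assms in \<open>auto simp: micro_def Let_def in_bounds_def\<close>)

text \<open>\<open>pre\<close> is the part already passed and the head is on the first cell of
  \<open>bs\<close>. Each \<open>True\<close> turned into \<open>False\<close> joins
  \<open>pre\<close>, following the recursion of \<open>binc\<close>. Where the carry stops depends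
  on the number, so the final head position is only bounded.\<close>

lemma reach_INC_carry:
  assumes "pc < length P" "P ! pc = INC v" "v < k" "i \<le> Suc (length x)"
    and "\<And>u. fst (W u) < space" "Suc (length (pre @ bs)) < space"
  shows "\<exists>h \<le> length (pre @ bs).
    reach P (mk (state pc 1) i (W(v := (Suc (length pre), tape_of (pre @ bs)))) os)
      (mk (state pc 2) i (W(v := (h, tape_of (pre @ binc bs)))) os)"
  using assms(6)
proof (induction bs arbitrary: pre rule: binc.induct)
  case 1
  have "reach P (mk (state pc 1) i (W(v := (Suc (length pre), tape_of (pre @ [])))) os)
      (mk (state pc 2) i (W(v := (length pre, tape_of (pre @ binc [])))) os)"
    by (rule reach_step[where F = "[v \<mapsto> (Bit True, Leftward)]" and d = Stay and out = None])
       (use assms 1 tape_of_append[of pre "[]"] in \<open>auto simp: micro_def Let_def tape_of_upd_snoc\<close>)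
  then show ?case by (intro exI[of _ "length pre"]) (simp del: fun_upd_apply)
next
  case (2 bs)
  have "reach P (mk (state pc 1) i (W(v := (Suc (length pre), tape_of (pre @ False # bs)))) os)
      (mk (state pc 2) i (W(v := (length pre, tape_of (pre @ binc (False # bs))))) os)"
    by (rule reach_step[where F = "[v \<mapsto> (Bit True, Leftward)]" and d = Stay and out = None])
       (use assms 2 in \<open>auto simp: micro_def Let_def tape_of_upd\<close>)
  then show ?case by (intro exI[of _ "length pre"]) (simp del: fun_upd_apply)
next
  case (3 bs)
  have "reach P (mk (state pc 1) i (W(v := (Suc (length pre), tape_of (pre @ True # bs)))) os)
      (mk (state pc 1) i (W(v := (Suc (length (pre @ [False])), tape_of ((pre @ [False]) @ bs)))) os)"
    by (rule reach_step[where F = "[v \<mapsto> (Bit False, Rightward)]" and d = Stay and out = None])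
       (use assms 3 in \<open>auto simp: micro_def Let_def tape_of_upd\<close>)
  also obtain h where "h \<le> length ((pre @ [False]) @ bs)"
    "reach P (mk (state pc 1) i (W(v := (Suc (length (pre @ [False])), tape_of ((pre @ [False]) @ bs)))) os)
      (mk (state pc 2) i (W(v := (h, tape_of ((pre @ [False]) @ binc bs)))) os)"
    using 3 by (metis append_Cons append_assoc append_Nil length_append length_Cons add_Suc_right)
  note this(2)
  finally show ?case using \<open>h \<le> _\<close> by (intro exI[of _ h]) (simp del: fun_upd_apply)
qed

text \<open>Bits are not blank, so the first blank met on the way left is cell 0.\<close>

lemma reach_INC_home:
  assumes "pc < length P" "P ! pc = INC v" "v < k" "i \<le> Suc (length x)"
    and "\<And>u. fst (W u) < space" "h < space" "h \<le> length bs"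
  shows "reach P (mk (state pc 2) i (W(v := (h, tape_of bs))) os)
      (mk (state (Suc pc) 0) i (W(v := (0, tape_of bs))) os)"
  using assms(6,7)
proof (induction h)
  case 0
  show ?case
    by (rule reach_step[where F = Map.empty and d = Stay and out = None])
       (use assms in \<open>auto simp: micro_def Let_def\<close>)
next
  case (Suc h)
  have "reach P (mk (state pc 2) i (W(v := (Suc h, tape_of bs))) os)
      (mk (state pc 2) i (W(v := (h, tape_of bs))) os)"
    by (rule reach_step[where F = "[v \<mapsto> (tape_of bs (Suc h), Leftward)]" and d = Stay and out = None])
       (use assms Suc in \<open>auto simp: micro_def Let_def tape_of_Suc\<close>)
  from reach_trans[OF this Suc.IH] show ?case using Suc.prems by linarith
qed

lemma in_bounds_space: "in_bounds \<sigma> i \<Longrightarrow> v < k \<Longrightarrow> Suc (length (bits (\<sigma> v))) < space"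
  using length_bits_mono[of "\<sigma> v" B] by (auto simp: in_bounds_def)

lemma reach_INC:
  assumes "pc < length P" "P ! pc = INC v" "v < k" "in_bounds \<sigma> i" "\<sigma> v < B"
  shows "reach P (conf pc \<sigma> i os) (conf (Suc pc) (\<sigma>(v := Suc (\<sigma> v))) i os)"
proof -
  note sp = in_bounds_space[OF assms(4,3)]
  have i: "i \<le> Suc (length x)" using assms by (simp add: in_bounds_def)
  let ?bs = "bits (\<sigma> v)"
  have "reach P (mk (state pc 0) i (rep \<sigma>) os) (mk (state pc 1) i ((rep \<sigma>)(v := (Suc (length []), tape_of ([] @ ?bs)))) os)"
    by (rule reach_step[where F = "[v \<mapsto> (Blank, Rightward)]" and d = Stay and out = None])
       (use assms sp i in \<open>auto simp: micro_def Let_def rep_def tape_of_upd_Nil\<close>)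
  also obtain h where h: "h \<le> length ?bs"
    "reach P (mk (state pc 1) i ((rep \<sigma>)(v := (Suc (length []), tape_of ([] @ ?bs)))) os)
      (mk (state pc 2) i ((rep \<sigma>)(v := (h, tape_of (binc ?bs)))) os)"
    using reach_INC_carry[OF assms(1-3) i, of "rep \<sigma>" "[]" ?bs os] sp by auto
  note h(2)
  also have "reach P (mk (state pc 2) i ((rep \<sigma>)(v := (h, tape_of (binc ?bs)))) os)
      (mk (state (Suc pc) 0) i ((rep \<sigma>)(v := (0, tape_of (binc ?bs)))) os)"
    using h(1) sp length_binc[of ?bs] by (intro reach_INC_home) (use assms i in auto)
  finally show ?thesis
    by (simp only: conf_def rep_upd bits_Suc[symmetric])
qed

text \<open>Nothing is erased on the way right: the marker at cell 0 is blank as well, so a head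
  amid erased cells could not find its way back.\<close>

lemma reach_ZERO_right:
  assumes "pc < length P" "P ! pc = ZERO v" "v < k" "i \<le> Suc (length x)"
    and "\<And>u. fst (W u) < space" "Suc (length bs) < space" "h \<le> length bs"
  shows "reach P (mk (state pc 1) i (W(v := (Suc h, tape_of bs))) os)
      (mk (state pc 2) i (W(v := (length bs, tape_of bs))) os)"
  using assms(7)
proof (induction h rule: inc_induct)
  case base
  have "(tape_of bs)(Suc (length bs) := Blank) = tape_of bs"
    by (rule ext) (simp add: tape_of_def)
  then show ?case
    by (intro reach_step[where F = "[v \<mapsto> (Blank, Leftward)]" and d = Stay and out = None])
       (use assms tape_of_append[of bs "[]"] in \<open>auto simp: micro_def Let_def\<close>)
next
  case (step h)
  have "reach P (mk (state pc 1) i (W(v := (Suc h, tape_of bs))) os)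
      (mk (state pc 1) i (W(v := (Suc (Suc h), tape_of bs))) os)"
    by (rule reach_step[where F = "[v \<mapsto> (tape_of bs (Suc h), Rightward)]" and d = Stay and out = None])
       (use assms step in \<open>auto simp: micro_def Let_def tape_of_Suc\<close>)
  from reach_trans[OF this step.IH] show ?case .
qed

text \<open>Erasing from the top down leaves a prefix of the bits, again of the form
  \<open>tape_of\<close>.\<close>

lemma reach_ZERO_erase:
  assumes "pc < length P" "P ! pc = ZERO v" "v < k" "i \<le> Suc (length x)"
    and "\<And>u. fst (W u) < space" "h < space" "h \<le> length bs"
  shows "reach P (mk (state pc 2) i (W(v := (h, tape_of (take h bs)))) os)
      (mk (state (Suc pc) 0) i (W(v := (0, tape_of []))) os)"
  using assms(6,7)
proof (induction h)
  case 0
  show ?case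
    by (rule reach_step[where F = Map.empty and d = Stay and out = None])
       (use assms in \<open>auto simp: micro_def Let_def\<close>)
next
  case (Suc h)
  have "reach P (mk (state pc 2) i (W(v := (Suc h, tape_of (take (Suc h) bs)))) os)
      (mk (state pc 2) i (W(v := (h, tape_of (take h bs)))) os)"
    by (rule reach_step[where F = "[v \<mapsto> (Blank, Leftward)]" and d = Stay and out = None])
       (use assms Suc in \<open>auto simp: micro_def Let_def tape_of_Suc tape_of_erase\<close>)
  from reach_trans[OF this Suc.IH] show ?case using Suc.prems by linarith
qed

lemma reach_ZERO:
  assumes "pc < length P" "P ! pc = ZERO v" "v < k" "in_bounds \<sigma> i"
  shows "reach P (conf pc \<sigma> i os) (conf (Suc pc) (\<sigma>(v := 0)) i os)"
proof -
  note sp = in_bounds_space[OF assms(4,3)]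
  have i: "i \<le> Suc (length x)" using assms by (simp add: in_bounds_def)
  let ?bs = "bits (\<sigma> v)"
  have "reach P (mk (state pc 0) i (rep \<sigma>) os) (mk (state pc 1) i ((rep \<sigma>)(v := (Suc 0, tape_of ?bs))) os)"
    by (rule reach_step[where F = "[v \<mapsto> (Blank, Rightward)]" and d = Stay and out = None])
       (use assms sp i in \<open>auto simp: micro_def Let_def rep_def tape_of_upd_Nil\<close>)
  also have "reach P \<dots> (mk (state pc 2) i ((rep \<sigma>)(v := (length ?bs, tape_of ?bs))) os)"
    using reach_ZERO_right[OF assms(1-3) i, of "rep \<sigma>" ?bs 0 os] sp by auto
  also have "reach P \<dots> (mk (state (Suc pc) 0) i ((rep \<sigma>)(v := (0, tape_of []))) os)"
    using reach_ZERO_erase[OF assms(1-3) i, of "rep \<sigma>" "length ?bs" ?bs os] sp by auto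
  finally show ?thesis
    by (simp only: conf_def rep_upd bits_0[symmetric])
qed

text \<open>The heads move in lockstep and stop at the first difference or at the common end; a
  proper prefix shows up as a blank against a bit. They stop at one position \<open>h\<close> within
  both numbers, on which the return relies.\<close>

lemma reach_TEST_Eq_compare:
  assumes "pc < length P" "P ! pc = TEST (Eq u v) l" "u < k" "v < k" "u \<noteq> v" "i \<le> Suc (length x)"
    and "\<And>u. fst (W u) < space" "Suc (length (pre @ as)) < space" "Suc (length (pre @ bs)) < space"
  shows "\<exists>h \<le> min (length (pre @ as)) (length (pre @ bs)).
    reach P (mk (state pc 1) i (W(u := (Suc (length pre), tape_of (pre @ as)), v := (Suc (length pre), tape_of (pre @ bs)))) os)
      (mk (state pc (if as = bs then 2 else 3)) i (W(u := (h, tape_of (pre @ as)), v := (h, tape_of (pre @ bs)))) os)"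
  using assms(8,9)
proof (induction as arbitrary: pre bs)
  case Nil
  have "(tape_of (pre @ bs))(Suc (length pre) := (case bs of [] \<Rightarrow> Blank | b # _ \<Rightarrow> Bit b)) = tape_of (pre @ bs)" for bs
    by (metis fun_upd_triv tape_of_append)
  from this[of "[]"] this[of bs]
  have "reach P (mk (state pc 1) i (W(u := (Suc (length pre), tape_of (pre @ [])), v := (Suc (length pre), tape_of (pre @ bs)))) os)
      (mk (state pc (if [] = bs then 2 else 3)) i (W(u := (length pre, tape_of (pre @ [])), v := (length pre, tape_of (pre @ bs)))) os)"
    by (intro reach_step[where F = "[u \<mapsto> (Blank, Leftward), v \<mapsto> (case bs of [] \<Rightarrow> Blank | b # _ \<Rightarrow> Bit b, Leftward)]" and d = Stay and out = None])
       (use assms Nil tape_of_append[of pre "[]"] in \<open>auto simp: micro_def Let_def split: list.split\<close>)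
  then show ?case by (intro exI[of _ "length pre"]) (simp del: fun_upd_apply)
next
  case (Cons a as)
  show ?case
  proof (cases "\<exists>bs'. bs = a # bs'")
    case True
    then obtain bs' where bs: "bs = a # bs'" by blast
    have "reach P (mk (state pc 1) i (W(u := (Suc (length pre), tape_of (pre @ a # as)), v := (Suc (length pre), tape_of (pre @ bs)))) os)
      (mk (state pc 1) i (W(u := (Suc (length (pre @ [a])), tape_of ((pre @ [a]) @ as)), v := (Suc (length (pre @ [a])), tape_of ((pre @ [a]) @ bs')))) os)"
      by (rule reach_step[where F = "[u \<mapsto> (Bit a, Rightward), v \<mapsto> (Bit a, Rightward)]" and d = Stay and out = None])
         (use assms Cons bs in \<open>auto simp: micro_def Let_def tape_of_upd\<close>)
    also obtain h where h: "h \<le> min (length ((pre @ [a]) @ as)) (length ((pre @ [a]) @ bs'))"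
      "reach P (mk (state pc 1) i (W(u := (Suc (length (pre @ [a])), tape_of ((pre @ [a]) @ as)), v := (Suc (length (pre @ [a])), tape_of ((pre @ [a]) @ bs')))) os)
      (mk (state pc (if as = bs' then 2 else 3)) i (W(u := (h, tape_of ((pre @ [a]) @ as)), v := (h, tape_of ((pre @ [a]) @ bs')))) os)"
      using Cons.IH[of "pre @ [a]" bs'] Cons.prems bs by (auto simp del: fun_upd_apply)
    note h(2)
    finally show ?thesis using h(1) bs by (intro exI[of _ h]) (simp del: fun_upd_apply)
  next
    case False
    define c where "c = (case bs of [] \<Rightarrow> Blank | b # _ \<Rightarrow> Bit b)"
    have c: "tape_of (pre @ bs) (Suc (length pre)) = c" "c \<noteq> Bit a" "a # as \<noteq> bs"
      using False by (auto simp: c_def split: list.split)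
    have "(tape_of (pre @ bs))(Suc (length pre) := c) = tape_of (pre @ bs)"
      by (simp add: c(1)[symmetric] del: tape_of_append)
    with c have "reach P (mk (state pc 1) i (W(u := (Suc (length pre), tape_of (pre @ a # as)), v := (Suc (length pre), tape_of (pre @ bs)))) os)
      (mk (state pc (if a # as = bs then 2 else 3)) i (W(u := (length pre, tape_of (pre @ a # as)), v := (length pre, tape_of (pre @ bs)))) os)"
    by (intro reach_step[where F = "[u \<mapsto> (Bit a, Leftward), v \<mapsto> (c, Leftward)]" and d = Stay and out = None])
       (use assms Cons in \<open>auto simp: micro_def Let_def tape_of_upd simp del: tape_of_append simp: tape_of_append[of _ "_ # _"]\<close>)
    then show ?thesis by (intro exI[of _ "length pre"]) (simp del: fun_upd_apply)
  qed
qed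

text \<open>With both heads on the same cell, a blank on tape \<open>u\<close> alone tells that both
  are home.\<close>

lemma reach_TEST_Eq_home:
  assumes "pc < length P" "P ! pc = TEST (Eq u v) l" "u < k" "v < k" "u \<noteq> v" "i \<le> Suc (length x)" "l \<le> length P"
    and "\<And>u. fst (W u) < space" "h < space" "h \<le> length as" "h \<le> length bs"
  shows "reach P (mk (state pc (if b then 2 else 3)) i (W(u := (h, tape_of as), v := (h, tape_of bs))) os)
      (mk (state (if b then l else Suc pc) 0) i (W(u := (0, tape_of as), v := (0, tape_of bs))) os)"
  using assms(9-)
proof (induction h)
  case 0
  show ?case
    by (rule reach_step[where F = Map.empty and d = Stay and out = None])
       (use assms in \<open>auto simp: micro_def Let_def\<close>)
next
  case (Suc h)
  have "reach P (mk (state pc (if b then 2 else 3)) i (W(u := (Suc h, tape_of as), v := (Suc h, tape_of bs))) os)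
      (mk (state pc (if b then 2 else 3)) i (W(u := (h, tape_of as), v := (h, tape_of bs))) os)"
    by (rule reach_step[where F = "[u \<mapsto> (tape_of as (Suc h), Leftward), v \<mapsto> (tape_of bs (Suc h), Leftward)]" and d = Stay and out = None])
       (use assms Suc in \<open>auto simp: micro_def Let_def tape_of_Suc\<close>)
  from reach_trans[OF this Suc.IH] show ?case using Suc.prems by linarith
qed

lemma reach_TEST_Eq:
  assumes "pc < length P" "P ! pc = TEST (Eq u v) l" "u < k" "v < k" "u \<noteq> v" "in_bounds \<sigma> i" "l \<le> length P"
  shows "reach P (conf pc \<sigma> i os) (conf (if \<sigma> u = \<sigma> v then l else Suc pc) \<sigma> i os)"
proof -
  note sp = in_bounds_space[OF assms(6,3)] in_bounds_space[OF assms(6,4)]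
  have i: "i \<le> Suc (length x)" using assms by (simp add: in_bounds_def)
  let ?as = "bits (\<sigma> u)" and ?bs = "bits (\<sigma> v)"
  have "reach P (mk (state pc 0) i (rep \<sigma>) os)
      (mk (state pc 1) i ((rep \<sigma>)(u := (Suc (length []), tape_of ([] @ ?as)), v := (Suc (length []), tape_of ([] @ ?bs)))) os)"
    by (rule reach_step[where F = "[u \<mapsto> (Blank, Rightward), v \<mapsto> (Blank, Rightward)]" and d = Stay and out = None])
       (use assms sp i in \<open>auto simp: micro_def Let_def rep_def tape_of_upd_Nil\<close>)
  also obtain h where h: "h \<le> min (length ([] @ ?as)) (length ([] @ ?bs))"
    "reach P (mk (state pc 1) i ((rep \<sigma>)(u := (Suc (length []), tape_of ([] @ ?as)), v := (Suc (length []), tape_of ([] @ ?bs)))) os)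
      (mk (state pc (if ?as = ?bs then 2 else 3)) i ((rep \<sigma>)(u := (h, tape_of ([] @ ?as)), v := (h, tape_of ([] @ ?bs)))) os)"
    using reach_TEST_Eq_compare[OF assms(1-5) i, of "rep \<sigma>" "[]" ?as ?bs os] sp by auto
  note h(2)
  also have "reach P (mk (state pc (if ?as = ?bs then 2 else 3)) i ((rep \<sigma>)(u := (h, tape_of ([] @ ?as)), v := (h, tape_of ([] @ ?bs)))) os)
      (mk (state (if ?as = ?bs then l else Suc pc) 0) i ((rep \<sigma>)(u := (0, tape_of ?as), v := (0, tape_of ?bs))) os)"
    unfolding append_Nil
    using h(1) sp by (intro reach_TEST_Eq_home) (use assms i in auto)
  finally show ?thesis
    by (simp only: conf_def rep_triv bits_inject)
qed

end

section \<open>Structured counter programs\<close>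

datatype com = Skip | Inc nat | Zero nat | Out bool | Mov dir | Seq com com (infixr ";;" 60)
  | Cond test com com | Until test com

text \<open>The exit tests equality, so the body is executed exactly \<open>\<sigma> w\<close> times
  if it leaves \<open>v\<close> and \<open>w\<close> alone.\<close>

definition For :: "nat \<Rightarrow> nat \<Rightarrow> com \<Rightarrow> com" where
  "For v w c = Zero v ;; Until (Eq v w) (c ;; Inc v)"

fun com_length :: "com \<Rightarrow> nat" where
  "com_length Skip = 0"
| "com_length (c ;; d) = com_length c + com_length d"
| "com_length (Cond b c d) = com_length c + com_length d + 2"
| "com_length (Until b c) = com_length c + 2"
| "com_length _ = 1"

text \<open>Jumps are absolute, so the start address \<open>a\<close> is passed along. A successful
  \<open>TEST\<close> jumps, hence the branch for failure comes first.\<close>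

fun compile :: "com \<Rightarrow> nat \<Rightarrow> instr list" where
  "compile Skip a = []"
| "compile (Inc v) a = [INC v]"
| "compile (Zero v) a = [ZERO v]"
| "compile (Out b) a = [OUT b]"
| "compile (Mov d) a = [MOV d]"
| "compile (c ;; d) a = compile c a @ compile d (a + com_length c)"
| "compile (Cond b c d) a =
    TEST b (a + com_length d + 2) # compile d (Suc a) @
    JMP (a + com_length d + com_length c + 2) # compile c (a + com_length d + 2)"
| "compile (Until b c) a = TEST b (a + com_length c + 2) # compile c (Suc a) @ [JMP a]"

lemma length_compile [simp]: "length (compile c a) = com_length c"
  by (induction c arbitrary: a) auto

definition code_at :: "instr list \<Rightarrow> nat \<Rightarrow> instr list \<Rightarrow> bool" where
  "code_at P a C \<longleftrightarrow> (\<exists>pre post. P = pre @ C @ post \<and> length pre = a)"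

lemma code_at_append: "code_at P a (C @ D) \<longleftrightarrow> code_at P a C \<and> code_at P (a + length C) D"
proof
  assume "code_at P a (C @ D)"
  then obtain pre post where "P = pre @ C @ D @ post" "length pre = a"
    by (auto simp: code_at_def)
  then show "code_at P a C \<and> code_at P (a + length C) D"
    unfolding code_at_def by (metis append.assoc length_append)
next
  assume "code_at P a C \<and> code_at P (a + length C) D"
  then obtain pre post pre' post' where "P = pre @ C @ post" "length pre = a"
    "P = (pre' @ D @ post')" "length pre' = a + length C"
    unfolding code_at_def by metis
  then have "pre @ C = pre'"
    by (metis append.assoc append_eq_append_conv length_append)
  then show "code_at P a (C @ D)"
    unfolding code_at_def using \<open>P = pre' @ D @ post'\<close> \<open>length pre = a\<close>
    by (metis append.assoc)
qed

lemma code_at_Cons: "code_at P a (i # C) \<longleftrightarrow> a < length P \<and> P ! a = i \<and> code_at P (Suc a) C"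
proof -
  have "code_at P a [i] \<longleftrightarrow> a < length P \<and> P ! a = i"
    unfolding code_at_def using id_take_nth_drop[of a P] by (force simp: nth_append)
  then show ?thesis using code_at_append[of P a "[i]" C] by simp
qed

lemma code_at_length: "code_at P a C \<Longrightarrow> a + length C \<le> length P"
  by (auto simp: code_at_def)

fun holds :: "bool list \<Rightarrow> test \<Rightarrow> (nat \<Rightarrow> nat) \<Rightarrow> nat \<Rightarrow> bool" where
  "holds x (Eq u v) \<sigma> i \<longleftrightarrow> \<sigma> u = \<sigma> v"
| "holds x (In s) \<sigma> i \<longleftrightarrow> in_read x i = s"

section \<open>Hoare rules for compiled programs\<close>

context counter_space
begin

fun test_ok :: "test \<Rightarrow> bool" where
  "test_ok (Eq u v) \<longleftrightarrow> u < k \<and> v < k \<and> u \<noteq> v"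
| "test_ok (In s) \<longleftrightarrow> True"

lemma reach_TEST:
  assumes "pc < length P" "P ! pc = TEST b l" "test_ok b" "in_bounds \<sigma> i" "l \<le> length P"
  shows "reach P (conf pc \<sigma> i os) (conf (if holds x b \<sigma> i then l else Suc pc) \<sigma> i os)"
  using assms reach_TEST_Eq reach_TEST_In by (cases b) auto

text \<open>
  Total correctness of the compiled code at every position of every program. The space bound is part
  of it: \<^const>\<open>reach\<close> admits only steps that keep the heads in bounds.
\<close>

definition triple :: "((nat \<Rightarrow> nat) \<Rightarrow> nat \<Rightarrow> bool) \<Rightarrow> com \<Rightarrow> ((nat \<Rightarrow> nat) \<Rightarrow> nat \<Rightarrow> bool) \<Rightarrow> bool list \<Rightarrow> bool"
  where "triple Pre c Post out \<longleftrightarrow>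
    (\<forall>P a \<sigma> i os. code_at P a (compile c a) \<longrightarrow> Pre \<sigma> i \<longrightarrow> in_bounds \<sigma> i \<longrightarrow>
      (\<exists>\<sigma>' i'. Post \<sigma>' i' \<and> in_bounds \<sigma>' i' \<and>
        reach P (conf a \<sigma> i os) (conf (a + com_length c) \<sigma>' i' (os @ out))))"

lemma tripleI:
  assumes "\<And>P a \<sigma> i os. code_at P a (compile c a) \<Longrightarrow> Pre \<sigma> i \<Longrightarrow> in_bounds \<sigma> i \<Longrightarrow>
      (\<exists>\<sigma>' i'. Post \<sigma>' i' \<and> in_bounds \<sigma>' i' \<and>
        reach P (conf a \<sigma> i os) (conf (a + com_length c) \<sigma>' i' (os @ out)))"
  shows "triple Pre c Post out"
  using assms unfolding triple_def by blast

lemma tripleE: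
  assumes "triple Pre c Post out" "code_at P a (compile c a)" "Pre \<sigma> i" "in_bounds \<sigma> i"
  obtains \<sigma>' i' where "Post \<sigma>' i'" "in_bounds \<sigma>' i'"
    "reach P (conf a \<sigma> i os) (conf (a + com_length c) \<sigma>' i' (os @ out))"
  using assms unfolding triple_def by blast

lemma triple_conseq:
  assumes "triple Pre c Post out" "\<And>\<sigma> i. Pre' \<sigma> i \<Longrightarrow> in_bounds \<sigma> i \<Longrightarrow> Pre \<sigma> i"
    "\<And>\<sigma> i. Post \<sigma> i \<Longrightarrow> in_bounds \<sigma> i \<Longrightarrow> Post' \<sigma> i" "out = out'"
  shows "triple Pre' c Post' out'"
  using assms unfolding triple_def by metis

lemma triple_Skip:
  assumes "\<And>\<sigma> i. Pre \<sigma> i \<Longrightarrow> in_bounds \<sigma> i \<Longrightarrow> Post \<sigma> i"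
  shows "triple Pre Skip Post []"
  using assms by (auto simp: triple_def)

lemma triple_Inc:
  assumes "v < k" "\<And>\<sigma> i. Pre \<sigma> i \<Longrightarrow> in_bounds \<sigma> i \<Longrightarrow> \<sigma> v < B \<and> Post (\<sigma>(v := Suc (\<sigma> v))) i"
  shows "triple Pre (Inc v) Post []"
proof (rule tripleI)
  fix P a \<sigma> i os
  assume *: "code_at P a (compile (Inc v) a)" "Pre \<sigma> i" "in_bounds \<sigma> i"
  then show "\<exists>\<sigma>' i'. Post \<sigma>' i' \<and> in_bounds \<sigma>' i' \<and>
        reach P (conf a \<sigma> i os) (conf (a + com_length (Inc v)) \<sigma>' i' (os @ []))"
    using assms(2)[OF *(2,3)] reach_INC[OF _ _ assms(1) *(3), of a P os]
    by (intro exI[of _ "\<sigma>(v := Suc (\<sigma> v))"] exI[of _ i]) (auto simp: code_at_Cons in_bounds_def)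
qed

lemma triple_Zero:
  assumes "v < k" "\<And>\<sigma> i. Pre \<sigma> i \<Longrightarrow> in_bounds \<sigma> i \<Longrightarrow> Post (\<sigma>(v := 0)) i"
  shows "triple Pre (Zero v) Post []"
proof (rule tripleI)
  fix P a \<sigma> i os
  assume *: "code_at P a (compile (Zero v) a)" "Pre \<sigma> i" "in_bounds \<sigma> i"
  then show "\<exists>\<sigma>' i'. Post \<sigma>' i' \<and> in_bounds \<sigma>' i' \<and>
        reach P (conf a \<sigma> i os) (conf (a + com_length (Zero v)) \<sigma>' i' (os @ []))"
    using assms(2)[OF *(2,3)] reach_ZERO[OF _ _ assms(1) *(3), of a P os]
    by (intro exI[of _ "\<sigma>(v := 0)"] exI[of _ i]) (auto simp: code_at_Cons in_bounds_def)
qed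

lemma triple_Out:
  assumes "\<And>\<sigma> i. Pre \<sigma> i \<Longrightarrow> in_bounds \<sigma> i \<Longrightarrow> Post \<sigma> i"
  shows "triple Pre (Out b) Post [b]"
  using assms reach_OUT by (fastforce intro!: tripleI simp: code_at_Cons)

lemma triple_Mov:
  assumes "\<And>\<sigma> i. Pre \<sigma> i \<Longrightarrow> in_bounds \<sigma> i \<Longrightarrow> Post \<sigma> (min (move d i) (Suc (length x)))"
  shows "triple Pre (Mov d) Post []"
proof (rule tripleI)
  fix P a \<sigma> i os
  assume *: "code_at P a (compile (Mov d) a)" "Pre \<sigma> i" "in_bounds \<sigma> i"
  then show "\<exists>\<sigma>' i'. Post \<sigma>' i' \<and> in_bounds \<sigma>' i' \<and>
        reach P (conf a \<sigma> i os) (conf (a + com_length (Mov d)) \<sigma>' i' (os @ []))"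
    using assms[OF *(2,3)] reach_MOV[OF _ _ *(3), of a P d os]
    by (intro exI[of _ \<sigma>] exI[of _ "min (move d i) (Suc (length x))"]) (auto simp: code_at_Cons in_bounds_def)
qed

lemma triple_Seq:
  assumes "triple Pre c Mid outc" "triple Mid d Post outd" "out = outc @ outd"
  shows "triple Pre (c ;; d) Post out"
proof (rule tripleI)
  fix P a \<sigma> i os
  assume *: "code_at P a (compile (c ;; d) a)" "Pre \<sigma> i" "in_bounds \<sigma> i"
  then have code: "code_at P a (compile c a)" "code_at P (a + com_length c) (compile d (a + com_length c))"
    by (auto simp: code_at_append)
  obtain \<sigma>1 i1 where 1: "Mid \<sigma>1 i1" "in_bounds \<sigma>1 i1"
    "reach P (conf a \<sigma> i os) (conf (a + com_length c) \<sigma>1 i1 (os @ outc))"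
    using tripleE[OF assms(1) code(1) *(2,3)] by blast
  obtain \<sigma>2 i2 where 2: "Post \<sigma>2 i2" "in_bounds \<sigma>2 i2"
    "reach P (conf (a + com_length c) \<sigma>1 i1 (os @ outc)) (conf (a + com_length c + com_length d) \<sigma>2 i2 ((os @ outc) @ outd))"
    using tripleE[OF assms(2) code(2) 1(1,2)] by blast
  from reach_trans[OF 1(3) 2(3)] 2(1,2)
  show "\<exists>\<sigma>' i'. Post \<sigma>' i' \<and> in_bounds \<sigma>' i' \<and>
        reach P (conf a \<sigma> i os) (conf (a + com_length (c ;; d)) \<sigma>' i' (os @ out))"
    by (auto simp: assms(3) add.assoc)
qed

lemma triple_Cond:
  assumes "test_ok b"
    and c: "triple (\<lambda>\<sigma> i. Pre \<sigma> i \<and> holds x b \<sigma> i) c Post out"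
    and d: "triple (\<lambda>\<sigma> i. Pre \<sigma> i \<and> \<not> holds x b \<sigma> i) d Post out"
  shows "triple Pre (Cond b c d) Post out"
proof (rule tripleI)
  fix P a \<sigma> i os
  assume *: "code_at P a (compile (Cond b c d) a)" "Pre \<sigma> i" "in_bounds \<sigma> i"
  define e where "e = a + com_length d + com_length c + 2"
  from * have code: "a < length P" "P ! a = TEST b (a + com_length d + 2)"
    "code_at P (Suc a) (compile d (Suc a))"
    "Suc a + com_length d < length P" "P ! (Suc a + com_length d) = JMP e"
    "code_at P (a + com_length d + 2) (compile c (a + com_length d + 2))"
    by (auto simp: code_at_append code_at_Cons e_def)
  have len: "e \<le> length P" using code_at_length[OF *(1)] by (simp add: e_def)
  have t: "reach P (conf a \<sigma> i os) (conf (if holds x b \<sigma> i then a + com_length d + 2 else Suc a) \<sigma> i os)"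
    using len by (intro reach_TEST[OF code(1,2) assms(1) *(3)]) (simp add: e_def)
  have "\<exists>\<sigma>' i'. Post \<sigma>' i' \<and> in_bounds \<sigma>' i' \<and> reach P (conf a \<sigma> i os) (conf e \<sigma>' i' (os @ out))"
  proof (cases "holds x b \<sigma> i")
    case True
    obtain \<sigma>1 i1 where 1: "Post \<sigma>1 i1" "in_bounds \<sigma>1 i1"
      "reach P (conf (a + com_length d + 2) \<sigma> i os) (conf (a + com_length d + 2 + com_length c) \<sigma>1 i1 (os @ out))"
      using tripleE[OF c code(6) _ *(3)] True *(2) by blast
    have "e = a + com_length d + 2 + com_length c" by (simp add: e_def)
    then have "reach P (conf a \<sigma> i os) (conf e \<sigma>1 i1 (os @ out))"
      using reach_trans[OF t] 1(3) True by simp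
    then show ?thesis using 1 by blast
  next
    case False
    obtain \<sigma>1 i1 where 1: "Post \<sigma>1 i1" "in_bounds \<sigma>1 i1"
      "reach P (conf (Suc a) \<sigma> i os) (conf (Suc a + com_length d) \<sigma>1 i1 (os @ out))"
      using tripleE[OF d code(3) _ *(3)] False *(2) by blast
    with reach_trans[OF t] False
    have "reach P (conf a \<sigma> i os) (conf (Suc a + com_length d) \<sigma>1 i1 (os @ out))" by simp
    from reach_trans[OF this reach_JMP[OF code(4,5) len 1(2)]] 1 show ?thesis by blast
  qed
  moreover have "e = a + com_length (Cond b c d)" by (simp add: e_def)
  ultimately show "\<exists>\<sigma>' i'. Post \<sigma>' i' \<and> in_bounds \<sigma>' i' \<and>
        reach P (conf a \<sigma> i os) (conf (a + com_length (Cond b c d)) \<sigma>' i' (os @ out))" by simp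
qed

text \<open>\<open>I\<close> is indexed by the completed rounds, and the test holds at
  \<open>I n\<close> but at no earlier \<open>I j\<close>. This gives termination after exactly
  \<open>n\<close> rounds, with an output that may vary from round to round.\<close>

lemma triple_Until:
  assumes "test_ok b"
    and c: "\<And>j. j < n \<Longrightarrow> triple (\<lambda>\<sigma> i. I j \<sigma> i \<and> \<not> holds x b \<sigma> i) c (I (Suc j)) (out j)"
    and b: "\<And>j \<sigma> i. j \<le> n \<Longrightarrow> I j \<sigma> i \<Longrightarrow> in_bounds \<sigma> i \<Longrightarrow> holds x b \<sigma> i \<longleftrightarrow> j = n"
  shows "triple (I 0) (Until b c) (I n) (concat (map out [0..<n]))"
proof (rule tripleI)
  fix P a \<sigma> i os
  assume *: "code_at P a (compile (Until b c) a)" "I 0 \<sigma> i" "in_bounds \<sigma> i"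
  define e where "e = a + com_length c + 2"
  from * have code: "a < length P" "P ! a = TEST b e"
    "code_at P (Suc a) (compile c (Suc a))"
    "Suc a + com_length c < length P" "P ! (Suc a + com_length c) = JMP a"
    by (auto simp: code_at_append code_at_Cons e_def)
  have len: "e \<le> length P" "a \<le> length P" using code_at_length[OF *(1)] by (simp_all add: e_def)
  have "\<exists>\<sigma>' i'. I m \<sigma>' i' \<and> in_bounds \<sigma>' i' \<and>
      reach P (conf a \<sigma> i os) (conf a \<sigma>' i' (os @ concat (map out [0..<m])))" if "m \<le> n" for m
    using that
  proof (induction m)
    case 0
    show ?case using * by auto
  next
    case (Suc m)
    then obtain \<sigma>1 i1 where 1: "I m \<sigma>1 i1" "in_bounds \<sigma>1 i1"
      "reach P (conf a \<sigma> i os) (conf a \<sigma>1 i1 (os @ concat (map out [0..<m])))" by auto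
    have nb: "\<not> holds x b \<sigma>1 i1" using b[OF _ 1(1,2)] Suc.prems by simp
    note 1(3)
    also have "reach P (conf a \<sigma>1 i1 (os @ concat (map out [0..<m]))) (conf (Suc a) \<sigma>1 i1 (os @ concat (map out [0..<m])))"
      using reach_TEST[OF code(1,2) assms(1) 1(2) len(1)] nb by simp
    also obtain \<sigma>2 i2 where 2: "I (Suc m) \<sigma>2 i2" "in_bounds \<sigma>2 i2"
      "reach P (conf (Suc a) \<sigma>1 i1 (os @ concat (map out [0..<m]))) (conf (Suc a + com_length c) \<sigma>2 i2 ((os @ concat (map out [0..<m])) @ out m))"
      using tripleE[OF c code(3) _ 1(2)] 1(1) nb Suc.prems by (metis Suc_le_lessD)
    note 2(3)
    also note reach_JMP[OF code(4,5) len(2) 2(2)]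
    finally show ?case using 2(1,2) by auto
  qed
  from this[of n] obtain \<sigma>1 i1 where 1: "I n \<sigma>1 i1" "in_bounds \<sigma>1 i1"
      "reach P (conf a \<sigma> i os) (conf a \<sigma>1 i1 (os @ concat (map out [0..<n])))" by auto
  note 1(3)
  also have "reach P (conf a \<sigma>1 i1 (os @ concat (map out [0..<n]))) (conf e \<sigma>1 i1 (os @ concat (map out [0..<n])))"
    using reach_TEST[OF code(1,2) assms(1) 1(2) len(1)] b[OF _ 1(1,2)] by simp
  finally show "\<exists>\<sigma>' i'. I n \<sigma>' i' \<and> in_bounds \<sigma>' i' \<and>
        reach P (conf a \<sigma> i os) (conf (a + com_length (Until b c)) \<sigma>' i' (os @ concat (map out [0..<n])))"
    using 1(1,2) by (auto simp: e_def)
qed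

text \<open>\<open>I\<close> has to be insensitive to \<open>v\<close>, so that it survives the
  reset and the increments of the loop counter; \<open>n \<le> B\<close> leaves room for the last
  increment.\<close>

lemma triple_For:
  assumes v: "v < k" "w < k" "v \<noteq> w" "n \<le> B"
    and c: "\<And>j. j < n \<Longrightarrow> triple (\<lambda>\<sigma> i. I j \<sigma> i \<and> \<sigma> v = j \<and> \<sigma> w = n) c (\<lambda>\<sigma> i. I (Suc j) \<sigma> i \<and> \<sigma> v = j \<and> \<sigma> w = n) (out j)"
    and I: "\<And>j \<sigma> i m. I j \<sigma> i \<Longrightarrow> I j (\<sigma>(v := m)) i"
  shows "triple (\<lambda>\<sigma> i. I 0 \<sigma> i \<and> \<sigma> w = n) (For v w c) (\<lambda>\<sigma> i. I n \<sigma> i \<and> \<sigma> w = n) (concat (map out [0..<n]))"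
  unfolding For_def
proof (rule triple_Seq)
  let ?I = "\<lambda>j \<sigma> i. I j \<sigma> i \<and> \<sigma> v = j \<and> \<sigma> w = n"
  show "triple (\<lambda>\<sigma> i. I 0 \<sigma> i \<and> \<sigma> w = n) (Zero v) (?I 0) []"
    using v I by (intro triple_Zero) auto
  have "triple (\<lambda>\<sigma> i. ?I j \<sigma> i \<and> \<not> holds x (Eq v w) \<sigma> i) (c ;; Inc v) (?I (Suc j)) (out j)" if "j < n" for j
  proof (rule triple_Seq)
    show "triple (\<lambda>\<sigma> i. ?I j \<sigma> i \<and> \<not> holds x (Eq v w) \<sigma> i) c (\<lambda>\<sigma> i. I (Suc j) \<sigma> i \<and> \<sigma> v = j \<and> \<sigma> w = n) (out j)"
      using c[OF that] by (rule triple_conseq) auto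
    show "triple (\<lambda>\<sigma> i. I (Suc j) \<sigma> i \<and> \<sigma> v = j \<and> \<sigma> w = n) (Inc v) (?I (Suc j)) []"
      using v I that by (intro triple_Inc) auto
  qed simp
  from triple_Until[of "Eq v w" n ?I, OF _ this]
  have "triple (?I 0) (Until (Eq v w) (c ;; Inc v)) (?I n) (concat (map out [0..<n]))"
    using v by auto
  then show "triple (?I 0) (Until (Eq v w) (c ;; Inc v)) (\<lambda>\<sigma> i. I n \<sigma> i \<and> \<sigma> w = n) (concat (map out [0..<n]))"
    by (rule triple_conseq) auto
qed simp

end

section \<open>From a triple to a logarithmic space transducer\<close>

lemma iterate_halt: "cf_state c = tr_halt M \<Longrightarrow> (tr_step M x ^^ n) c = c"
  by (induction n) (simp_all add: tr_step_def)

text \<open>Counters up to a polynomial \<open>bound\<close> have logarithmically many bits. The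
  comparison with a power of \<open>n\<close> starts at 2, since \<open>ln\<close> vanishes at
  1.\<close>

lemma logspace_computableI:
  fixes bound :: "nat \<Rightarrow> nat"
  assumes run: "\<And>x. counter_space.triple k x (bound (length x)) (\<lambda>\<sigma> i. \<sigma> = (\<lambda>_. 0) \<and> i = 0) c (\<lambda>\<sigma> i. True) (f x)"
    and bound: "\<And>n. 2 \<le> n \<Longrightarrow> bound n \<le> n ^ d" "\<And>n. 0 < bound n"
  shows "logspace_computable f"
proof -
  define P where "P = compile c 0"
  define M where "M = counter_transducer k P"
  define S where "S n = length (bits (bound n)) + 2" for n
  have main: "(\<exists>t. cf_state (tr_run M x t) = tr_halt M \<and> cf_output (tr_run M x t) = f x) \<and>
     (\<forall>t. \<forall>(h, tape) \<in> set (cf_work (tr_run M x t)). h < S (length x))" for x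
  proof -
    interpret counter_space k x "bound (length x)" .
    have code: "code_at P 0 (compile c 0)" by (auto simp: code_at_def P_def)
    obtain \<sigma>' i' where r: "reach P (conf 0 (\<lambda>_. 0) 0 []) (conf (0 + com_length c) \<sigma>' i' ([] @ f x))"
      by (rule tripleE[OF run code, of "\<lambda>_. 0" 0 "[]"]) (auto simp: in_bounds_def intro: that)
    have init: "conf 0 (\<lambda>_. 0) 0 [] = tr_init M"
      by (simp add: conf_def mk_def tr_init_def M_def counter_transducer_def state_def
          rep_def[abs_def] tape_of_Nil map_replicate_const)
    have ok0: "heads_ok (tr_init M)"
      by (auto simp: heads_ok_def tr_init_def)
    from reach_imp_run[OF r] ok0 obtain t where
      t: "tr_run M x t = conf (com_length c) \<sigma>' i' (f x)" "\<forall>s\<le>t. heads_ok (tr_run M x s)"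
      by (auto simp: init tr_run_def M_def)
    have halt: "cf_state (tr_run M x t) = tr_halt M"
      by (simp add: t(1)) (simp add: conf_def mk_def M_def counter_transducer_def P_def)
    \<comment> \<open>After time \<open>t\<close> the machine has halted and the configuration is
      constant, so the bound known up to \<open>t\<close> extends to all times.\<close>
    have "heads_ok (tr_run M x s)" for s
    proof (cases "s \<le> t")
      case False
      then have "tr_run M x s = (tr_step M x ^^ (s - t)) (tr_run M x t)"
        unfolding tr_run_def by (metis comp_apply funpow_add le_add_diff_inverse2 linorder_not_le nat_less_le)
      then show ?thesis using iterate_halt[OF halt] t(2) by simp
    qed (use t(2) in simp)
    moreover have "cf_output (tr_run M x t) = f x" by (simp add: t(1)) (simp add: conf_def mk_def)
    ultimately show ?thesis using halt by (auto simp: heads_ok_def S_def)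
  qed
  have "(\<lambda>n. real (S n)) \<in> O(\<lambda>n. ln (real n))"
  proof -
    have "real (length (bits (bound n))) \<le> ln (real (bound n)) / ln 2 + 1" for n
    proof -
      have "(2::real) ^ (length (bits (bound n)) - 1) \<le> real (bound n)"
        using length_bits_le[OF bound(2), of n] by (metis of_nat_le_iff of_nat_numeral of_nat_power)
      then have "ln ((2::real) ^ (length (bits (bound n)) - 1)) \<le> ln (real (bound n))"
        using bound(2)[of n] by (subst ln_le_cancel_iff) auto
      then have "real (length (bits (bound n)) - 1) * ln 2 \<le> ln (real (bound n))"
        by (simp add: ln_realpow)
      then have "real (length (bits (bound n)) - 1) \<le> ln (real (bound n)) / ln 2"
        by (simp add: pos_le_divide_eq)
      then show ?thesis by linarith
    qed
    note len = this
    \<comment> \<open>\<open>d\<close> is the exponent bounding \<open>bound\<close>; 3 is the 1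
      lost in rounding the logarithm plus the two extra cells, absorbed because
      \<open>ln 2 \<le> ln n\<close>.\<close>
    have "real (S n) \<le> (real d + 3) / ln 2 * ln (real n)" if n: "2 \<le> n" for n
    proof -
      have "ln (real (bound n)) \<le> ln (real n ^ d)"
        using bound(1)[OF n] bound(2)[of n] n
        by (subst ln_le_cancel_iff) (auto simp flip: of_nat_power)
      also have "\<dots> = real d * ln (real n)" using n by (simp add: ln_realpow)
      finally have "ln (real (bound n)) / ln 2 \<le> real d * ln (real n) / ln 2"
        by (simp add: divide_right_mono)
      moreover have "ln 2 \<le> ln (real n)" using n by simp
      then have "3 \<le> 3 * ln (real n) / ln 2" by (simp add: pos_le_divide_eq)
      ultimately show ?thesis
        using len[of n] by (simp add: S_def add_divide_distrib distrib_right)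
    qed
    then show ?thesis
      by (intro bigoI[of _ "(real d + 3) / ln 2"] eventually_sequentiallyI[of 2]) (auto simp: abs_le_iff)
  qed
  then show ?thesis
    using main counter_transducer_wf[of k P]
    unfolding logspace_computable_def tr_computes_def tr_runs_in_space_def M_def[symmetric]
    by blast
qed

section \<open>The circuit of a computation as a Kripke model\<close>

fun nor :: "nat \<Rightarrow> form" where
  "nor 0 = Bot"
| "nor (Suc m) = Box (Imp (nor m) Bot)"

lemma nor_strict: "nor m \<in> strict_imp_varfree"
  by (induction m) (auto intro: strict_imp_varfree.intros)

lemma var_bound_nor [simp]: "var_bound (nor m) = 0"
  by (induction m) auto

text \<open>\<open>[True, True, True, False]\<close> is the tag of \<open>Box\<close> followed by
  that of \<open>Imp\<close>. Prefix notation defers every consequent \<open>Bot\<close> behind the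
  innermost one, so two simple loops print the formula.\<close>

lemma enc_form_nor:
  "enc_form (nor m) = concat (replicate m [True, True, True, False]) @ [False, False] @ concat (replicate m [False, False])"
proof (induction m)
  case (Suc m)
  have "concat (replicate m [False, False]) @ [False, False] = [False, False] @ concat (replicate m [False, False])"
    by (induction m) auto
  then show ?case using Suc by simp
qed simp

text \<open>By induction on \<open>m\<close>: the successors have smaller rank, so one level less
  already decides them; at \<open>m = 0\<close> no world qualifies. Any solution
  \<open>truth\<close> of the NOR equations is thus the computed one.\<close>

lemma sat_nor:
  assumes rank: "\<And>w v. (w, v) \<in> rel M \<Longrightarrow> rank v < (rank w :: nat)"
    and eqn: "\<And>w. w \<in> W \<Longrightarrow> truth w \<longleftrightarrow> (\<forall>v. (w, v) \<in> rel M \<longrightarrow> \<not> truth v)"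
    and closed: "rel M \<subseteq> W \<times> W"
    and "w \<in> W" "rank w < m"
  shows "sat M w (nor m) \<longleftrightarrow> truth w"
  using assms(4,5)
proof (induction m arbitrary: w)
  case (Suc m)
  have "sat M v (nor m) \<longleftrightarrow> truth v" if "(w, v) \<in> rel M" for v
    using Suc.IH[of v] Suc.prems rank[OF that] closed that by auto
  then show ?case using eqn[OF Suc.prems(1)] by auto
qed simp

lemma sat_nor_cong: "rel M = rel N \<Longrightarrow> sat M w (nor m) \<longleftrightarrow> sat N w (nor m)"
  by (induction m arbitrary: w) auto

text \<open>Turns a run through all world numbers into nested loops over their digits.\<close>

lemma concat_map_upt_mult:
  "concat (map F [0..<D * m]) = concat (map (\<lambda>t. concat (map (\<lambda>r. F (t * m + r)) [0..<m])) [0..<D])"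
proof (induction D)
  case (Suc D)
  have "[0..<Suc D * m] = [0..<D * m] @ map (\<lambda>r. D * m + r) [0..<m]"
    using upt_add_eq_append[of 0 "D * m" m] map_add_upt[of "D * m" m] by (simp add: add.commute)
  then show ?case using Suc by (simp add: comp_def)
qed simp

lemma map_upt_mult:
  "map F [0..<D * m] = concat (map (\<lambda>t. map (\<lambda>r. F (t * m + r)) [0..<m]) [0..<D])"
  using concat_map_upt_mult[of "\<lambda>i. [F i]" D m] by simp

text \<open>
  \<open>Cell a\<close> and \<open>State q\<close> are negated literals, \<open>Act q a\<close> says that the head is
  here in state \<open>q\<close> reading \<open>a\<close>, and \<open>Idle a\<close> that the cell holds \<open>a\<close> and the head is elsewhere.
  The output gate is \<open>Reject\<close>: as a NOR gate it expresses that the machine does not reject.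
\<close>

datatype gate = Reject | One | Cell symbol | State nat | Act nat symbol | Idle symbol

text \<open>
  Counters of the transducer: the constant zero, \<open>length x + 1\<close>, the side length \<open>D\<close> of the
  tableau, the coordinates \<open>t, p, t', p'\<close> of two worlds, and the derived values
  \<open>t' + 1\<close>, \<open>p' - 1\<close>, \<open>p' + 1\<close>. Truncated subtraction agrees with a left move on cell 0.
\<close>

abbreviation (input) "vZ \<equiv> 0 :: nat"
abbreviation (input) "vN \<equiv> 1 :: nat"
abbreviation (input) "vD \<equiv> 2 :: nat"
abbreviation (input) "vT \<equiv> 3 :: nat"
abbreviation (input) "vP \<equiv> 4 :: nat"
abbreviation (input) "vT' \<equiv> 5 :: nat"
abbreviation (input) "vP' \<equiv> 6 :: nat"
abbreviation (input) "vS \<equiv> 7 :: nat"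
abbreviation (input) "vL \<equiv> 8 :: nat"
abbreviation (input) "vR \<equiv> 9 :: nat"

definition env :: "nat \<Rightarrow> nat \<Rightarrow> nat \<Rightarrow> nat \<Rightarrow> nat \<Rightarrow> nat" where
  "env t p t' p' = (\<lambda>_. 0)(vT := t, vP := p, vT' := t', vP' := p', vS := Suc t', vL := p' - 1, vR := Suc p')"

fun dir_var :: "dir \<Rightarrow> nat" where
  "dir_var Leftward = vL"
| "dir_var Stay = vP'"
| "dir_var Rightward = vR"

section \<open>The tableau of a Turing machine as a NOR circuit\<close>

locale machine =
  fixes M :: tm
  assumes tm: "turing_machine M"
begin

text \<open>Halting states idle in place, as in \<open>tm_step\<close>, so that the verdict can be
  read off at a fixed time.\<close>

definition delta :: "nat \<Rightarrow> symbol \<Rightarrow> nat \<times> symbol \<times> dir" where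
  "delta q a = (if q = tm_accept M \<or> q = tm_reject M then (q, a, Stay) else tm_delta M q a)"

definition next_state :: "nat \<Rightarrow> symbol \<Rightarrow> nat" where "next_state q a = fst (delta q a)"
definition written :: "nat \<Rightarrow> symbol \<Rightarrow> symbol" where "written q a = fst (snd (delta q a))"
definition direction :: "nat \<Rightarrow> symbol \<Rightarrow> dir" where "direction q a = snd (snd (delta q a))"

text \<open>Edges are given by lists of tests, so that the same data define the circuit and are
  compiled into the printer. At time 0 an edge to the constant \<open>One\<close> turns a negated
  literal off; later \<open>Cell\<close> and \<open>State\<close> are turned off by those gates of
  the preceding step that produce the symbol or bring the head there in that state.
  \<open>Idle\<close> recognises the absence of the head by the absence of every \<open>Act\<close>
  in its cell.\<close>

fun wire :: "gate \<Rightarrow> gate \<Rightarrow> test list option" where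
  "wire Reject (Act q b) = (if q = tm_reject M then Some [Eq vT vT'] else None)"
| "wire (Cell a) One = (case a of Blank \<Rightarrow> Some [Eq vT vZ, In RightEnd]
      | Bit b \<Rightarrow> Some [Eq vT vZ, In (InBit b)] | Aux _ \<Rightarrow> None)"
| "wire (Cell a) (Idle b) = (if a = b then Some [Eq vT vS, Eq vP vP'] else None)"
| "wire (Cell a) (Act q b) = (if written q b = a then Some [Eq vT vS, Eq vP vP'] else None)"
| "wire (State q) One = (if q = tm_start M then Some [Eq vT vZ, Eq vP vZ] else None)"
| "wire (State q) (Act r b) = (if next_state r b = q then Some [Eq vT vS, Eq vP (dir_var (direction r b))] else None)"
| "wire (Act q b) (State r) = (if q = r then Some [Eq vT vT', Eq vP vP'] else None)"
| "wire (Act q b) (Cell a) = (if a = b then Some [Eq vT vT', Eq vP vP'] else None)"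
| "wire (Idle b) (Cell a) = (if a = b then Some [Eq vT vT', Eq vP vP'] else None)"
| "wire (Idle b) (Act q a) = Some [Eq vT vT', Eq vP vP']"
| "wire _ _ = None"

text \<open>
  The input head advances by one per pair \<open>(t, p)\<close>, so that it reads tape cell \<open>p\<close> of the
  initial configuration when \<open>t = 0\<close>; wires test the input only in that case.
\<close>

definition edge :: "bool list \<Rightarrow> nat \<Rightarrow> nat \<Rightarrow> nat \<Rightarrow> gate \<Rightarrow> nat \<Rightarrow> nat \<Rightarrow> gate \<Rightarrow> bool" where
  "edge x D t p g t' p' g' \<longleftrightarrow>
    (case wire g g' of None \<Rightarrow> False
     | Some bs \<Rightarrow> \<forall>b\<in>set bs. holds x b (env t p t' p') (Suc (t * D + p)))"

definition gate_set :: "gate set" where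
  "gate_set = {Reject, One} \<union> Cell ` tm_alphabet M \<union> State ` tm_states M \<union>
    (\<lambda>(q, b). Act q b) ` (tm_states M \<times> tm_alphabet M) \<union> Idle ` tm_alphabet M"

text \<open>\<open>Reject\<close> is put in front so that the output gate has number 0. Repetitions
  in the list are harmless: copies of a gate have the same wires and the same value.\<close>

definition gates :: "gate list" where
  "gates = Reject # (SOME gs. set gs = gate_set)"

lemma set_gates [simp]: "set gates = gate_set"
proof -
  have "finite gate_set" using tm by (auto simp: gate_set_def turing_machine_def)
  then have "set (SOME gs. set gs = gate_set) = gate_set"
    by (metis (mono_tags, lifting) finite_list someI_ex)
  then show ?thesis by (auto simp: gates_def gate_set_def)
qed

definition config :: "bool list \<Rightarrow> nat \<Rightarrow> tm_config" where
  "config x t = (tm_step M ^^ t) (tm_init M x)"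

definition st :: "bool list \<Rightarrow> nat \<Rightarrow> nat" where "st x t = fst (config x t)"
definition hd_pos :: "bool list \<Rightarrow> nat \<Rightarrow> nat" where "hd_pos x t = fst (snd (config x t))"
definition cell :: "bool list \<Rightarrow> nat \<Rightarrow> nat \<Rightarrow> symbol" where "cell x t = snd (snd (config x t))"

lemma config_0: "st x 0 = tm_start M" "hd_pos x 0 = 0"
    "cell x 0 p = (if p < length x then Bit (x ! p) else Blank)"
  by (simp_all add: st_def hd_pos_def cell_def config_def tm_init_def)

lemma config_Suc:
  "st x (Suc t) = next_state (st x t) (cell x t (hd_pos x t))"
  "hd_pos x (Suc t) = move (direction (st x t) (cell x t (hd_pos x t))) (hd_pos x t)"
  "cell x (Suc t) = (cell x t)(hd_pos x t := written (st x t) (cell x t (hd_pos x t)))"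
  by (simp_all add: st_def hd_pos_def cell_def config_def next_state_def direction_def written_def
      delta_def tm_step_def split_beta)

lemma delta_closed:
  assumes "q \<in> tm_states M" "a \<in> tm_alphabet M"
  shows "next_state q a \<in> tm_states M" "written q a \<in> tm_alphabet M"
  using tm assms
  by (auto simp: turing_machine_def next_state_def written_def delta_def mem_Times_iff)

lemma config_closed: "st x t \<in> tm_states M \<and> cell x t p \<in> tm_alphabet M"
proof (induction t arbitrary: p)
  case 0
  show ?case using tm by (cases "p < length x"; cases "x ! p") (auto simp: config_0 turing_machine_def)
next
  case (Suc t)
  then show ?case by (auto simp: config_Suc delta_closed)
qed

lemma hd_pos_le: "hd_pos x t \<le> t"
proof (induction t)
  case (Suc t)
  then show ?case by (cases "direction (st x t) (cell x t (hd_pos x t))") (auto simp: config_Suc)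
qed (simp add: config_0)

fun gate_val :: "bool list \<Rightarrow> nat \<Rightarrow> nat \<Rightarrow> gate \<Rightarrow> bool" where
  "gate_val x t p Reject \<longleftrightarrow> st x t \<noteq> tm_reject M"
| "gate_val x t p One \<longleftrightarrow> True"
| "gate_val x t p (Cell a) \<longleftrightarrow> cell x t p \<noteq> a"
| "gate_val x t p (State q) \<longleftrightarrow> \<not> (hd_pos x t = p \<and> st x t = q)"
| "gate_val x t p (Act q a) \<longleftrightarrow> hd_pos x t = p \<and> st x t = q \<and> cell x t p = a"
| "gate_val x t p (Idle a) \<longleftrightarrow> hd_pos x t \<noteq> p \<and> cell x t p = a"

text \<open>Within a time step the negated literals come before \<open>Act\<close>, and
  \<open>Act\<close> before \<open>Idle\<close> and \<open>Reject\<close>; the next step starts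
  above all of them. Ranks at times below \<open>D\<close> are below \<open>4 * D\<close>, the depth
  of the formula.\<close>

fun gate_rank :: "nat \<Rightarrow> gate \<Rightarrow> nat" where
  "gate_rank t Reject = 4 * t + 3"
| "gate_rank t One = 0"
| "gate_rank t (Cell a) = 4 * t + 1"
| "gate_rank t (State q) = 4 * t + 1"
| "gate_rank t (Act q a) = 4 * t + 2"
| "gate_rank t (Idle a) = 4 * t + 3"

lemma env_simps [simp]:
  "env t p t' p' vZ = 0" "env t p t' p' vT = t" "env t p t' p' vP = p" "env t p t' p' vT' = t'" 
  "env t p t' p' vP' = p'" "env t p t' p' vS = Suc t'" "env t p t' p' (dir_var d) = move d p'"
  by (cases d; simp add: env_def)+

lemma edge_rank: "edge x D t p g t' p' g' \<Longrightarrow> gate_rank t' g' < gate_rank t g"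
  by (cases g; cases g') (auto simp: edge_def split: if_splits symbol.splits)

lemma gate_set_simps [simp]:
  "Reject \<in> gate_set" "One \<in> gate_set"
  "Cell a \<in> gate_set \<longleftrightarrow> a \<in> tm_alphabet M" "State q \<in> gate_set \<longleftrightarrow> q \<in> tm_states M"
  "Act q a \<in> gate_set \<longleftrightarrow> q \<in> tm_states M \<and> a \<in> tm_alphabet M"
  "Idle a \<in> gate_set \<longleftrightarrow> a \<in> tm_alphabet M"
  by (auto simp: gate_set_def)

definition fires :: "bool list \<Rightarrow> nat \<Rightarrow> nat \<Rightarrow> nat \<Rightarrow> gate \<Rightarrow> bool" where
  "fires x D t p g \<longleftrightarrow>
    (\<exists>t' p' g'. t' < D \<and> p' < D \<and> g' \<in> gate_set \<and> edge x D t p g t' p' g' \<and> gate_val x t' p' g')"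

lemma firesI:
  "t' < D \<Longrightarrow> p' < D \<Longrightarrow> g' \<in> gate_set \<Longrightarrow> edge x D t p g t' p' g' \<Longrightarrow> gate_val x t' p' g' \<Longrightarrow> fires x D t p g"
  unfolding fires_def by blast

lemma firesE:
  assumes "fires x D t p g"
  obtains t' p' g' where "t' < D" "p' < D" "g' \<in> gate_set" "edge x D t p g t' p' g'" "gate_val x t' p' g'"
  using assms unfolding fires_def by blast

text \<open>A false gate finds its true successor in the actual configuration; conversely each kind
  of wire is checked separately. The witnesses lie in the \<open>D\<close> by \<open>D\<close>
  square because the head is at most at cell \<open>t\<close> at time \<open>t\<close>, and in
  \<open>gate_set\<close> because runs stay within the states and the alphabet.\<close>

lemma gate_val_fires:
  assumes "t < D" "p < D" "g \<in> gate_set"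
  shows "gate_val x t p g \<longleftrightarrow> \<not> fires x D t p g"
proof -
  let ?h = "hd_pos x t" and ?q = "st x t" 
  have h: "?h < D" using hd_pos_le[of x t] assms by simp
  note cl = config_closed[of x]
  show ?thesis
  proof (cases g)
    case Reject
    have "fires x D t p g" if "\<not> gate_val x t p g"
      by (rule firesI[of t _ ?h "Act ?q (cell x t ?h)"])
         (use assms h cl[of t ?h] that Reject in \<open>auto simp: edge_def\<close>)
    moreover have "\<not> gate_val x t p g" if "fires x D t p g"
      using that proof (rule firesE)
      fix t' p' g' assume "edge x D t p g t' p' g'" "gate_val x t' p' g'"
      then show ?thesis using Reject by (cases g') (auto simp: edge_def split: if_splits)
    qed
    ultimately show ?thesis by blast
  next
    case One
    then show ?thesis by (auto simp: fires_def edge_def)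
  next
    case (Cell a)
    show ?thesis
    proof (cases t)
      case 0
      \<comment> \<open>Any copy of \<open>One\<close> would do, as its wires put no condition on
        the time and cell of the target.\<close>
      have "fires x D t p g" if "\<not> gate_val x t p g"
        by (rule firesI[of 0 _ 0 "One"])
           (use assms h cl that Cell 0 in \<open>auto simp: edge_def config_0 in_read_def split: if_splits\<close>)
      moreover have "\<not> gate_val x t p g" if "fires x D t p g"
        using that proof (rule firesE)
        fix t' p' g' assume "edge x D t p g t' p' g'" "gate_val x t' p' g'"
        then show ?thesis using Cell 0
          by (cases g') (auto simp: edge_def config_0 in_read_def split: if_splits symbol.splits)
      qed
      ultimately show ?thesis by blast
    next
      case (Suc t1)
      let ?b = "cell x t1 p"
      \<comment> \<open>The symbol was either written by the head one step earlier or left over in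
        an idle cell.\<close>
      have "fires x D t p g" if "\<not> gate_val x t p g"
      proof (cases "hd_pos x t1 = p")
        case True
        show ?thesis
          by (rule firesI[of t1 _ p "Act (st x t1) ?b"])
             (use assms h cl that Cell Suc True in \<open>auto simp: edge_def config_Suc\<close>)
      next
        case False
        show ?thesis
          by (rule firesI[of t1 _ p "Idle ?b"])
             (use assms h cl that Cell Suc False in \<open>auto simp: edge_def config_Suc\<close>)
      qed
      moreover have "\<not> gate_val x t p g" if "fires x D t p g"
        using that proof (rule firesE)
        fix t' p' g' assume "edge x D t p g t' p' g'" "gate_val x t' p' g'"
        then show ?thesis using Cell Suc
          by (cases g') (auto simp: edge_def config_Suc split: if_splits symbol.splits)
      qed
      ultimately show ?thesis by blast
    qed
  next
    case (State q)
    show ?thesis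
    proof (cases t)
      case 0
      have "fires x D t p g" if "\<not> gate_val x t p g"
        by (rule firesI[of 0 _ 0 "One"])
           (use assms h cl that State 0 in \<open>auto simp: edge_def config_0 split: if_splits\<close>)
      moreover have "\<not> gate_val x t p g" if "fires x D t p g"
        using that proof (rule firesE)
        fix t' p' g' assume "edge x D t p g t' p' g'" "gate_val x t' p' g'"
        then show ?thesis using State 0
          by (cases g') (auto simp: edge_def config_0 split: if_splits)
      qed
      ultimately show ?thesis by blast
    next
      case (Suc t1)
      let ?b = "cell x t1 (hd_pos x t1)"
      \<comment> \<open>The witness sits where the head was one step earlier, in general a neighbour
        of \<open>p\<close>.\<close>
      have "fires x D t p g" if "\<not> gate_val x t p g"
        by (rule firesI[of t1 _ "hd_pos x t1" "Act (st x t1) ?b"])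
           (use assms hd_pos_le[of x t1] cl that State Suc in \<open>auto simp: edge_def config_Suc\<close>)
      moreover have "\<not> gate_val x t p g" if "fires x D t p g"
        using that proof (rule firesE)
        fix t' p' g' assume "edge x D t p g t' p' g'" "gate_val x t' p' g'"
        then show ?thesis using State Suc
          by (cases g') (auto simp: edge_def config_Suc split: if_splits)
      qed
      ultimately show ?thesis by blast
    qed
  next
    case (Act q a)
    have "fires x D t p g" if "\<not> gate_val x t p g"
    proof (cases "cell x t p = a")
      case True
      show ?thesis
        by (rule firesI[of t _ p "State q"])
           (use assms cl that Act True in \<open>auto simp: edge_def\<close>)
    next
      case False
      show ?thesis
        by (rule firesI[of t _ p "Cell a"])
           (use assms cl that Act False in \<open>auto simp: edge_def\<close>)
    qed
    moreover have "\<not> gate_val x t p g" if "fires x D t p g"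
      using that proof (rule firesE)
      fix t' p' g' assume "edge x D t p g t' p' g'" "gate_val x t' p' g'"
      then show ?thesis using Act by (cases g') (auto simp: edge_def split: if_splits)
    qed
    ultimately show ?thesis by blast
  next
    case (Idle a)
    \<comment> \<open>Either the cell holds another symbol or the head is here, and then the active
      \<open>Act\<close> is the witness.\<close>
    have "fires x D t p g" if "\<not> gate_val x t p g"
    proof (cases "cell x t p = a")
      case True
      show ?thesis
        by (rule firesI[of t _ p "Act ?q (cell x t p)"])
           (use assms cl that Idle True in \<open>auto simp: edge_def\<close>)
    next
      case False
      show ?thesis
        by (rule firesI[of t _ p "Cell a"])
           (use assms cl that Idle False in \<open>auto simp: edge_def\<close>)
    qed
    moreover have "\<not> gate_val x t p g" if "fires x D t p g"
      using that proof (rule firesE)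
      fix t' p' g' assume "edge x D t p g t' p' g'" "gate_val x t' p' g'"
      then show ?thesis using Idle by (cases g') (auto simp: edge_def split: if_splits)
    qed
    ultimately show ?thesis by blast
  qed
qed

section \<open>Gates numbered as worlds, and correctness of the reduction\<close>

abbreviation G :: nat where "G \<equiv> length gates"

lemma G_pos: "0 < G"
  by (simp add: gates_def)

text \<open>World \<open>t * (D * G) + (p * G + g)\<close> stands for time \<open>t\<close>, cell
  \<open>p\<close> and gate number \<open>g\<close>, in the order in which nested loops enumerate
  the triples.\<close>

definition world_edge :: "bool list \<Rightarrow> nat \<Rightarrow> nat \<Rightarrow> nat \<Rightarrow> bool" where
  "world_edge x D i j \<longleftrightarrow> edge x D (i div (D * G)) (i div G mod D) (gates ! (i mod G))
     (j div (D * G)) (j div G mod D) (gates ! (j mod G))"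

definition model :: "bool list \<Rightarrow> nat \<Rightarrow> nat kripke" where
  "model x D = \<lparr>worlds = {..<D * (D * G)},
     rel = {(i, j). i < D * (D * G) \<and> j < D * (D * G) \<and> world_edge x D i j}, val = \<lambda>_. {}\<rparr>"

lemma world_decode:
  assumes "p < D" "g < G"
  shows "(t * (D * G) + (p * G + g)) div (D * G) = t" "(t * (D * G) + (p * G + g)) div G mod D = p"
    "(t * (D * G) + (p * G + g)) mod G = g"
proof -
  have "p * G + g < Suc p * G" using assms by simp
  also have "\<dots> \<le> D * G" using assms by (intro mult_le_mono1) simp
  finally have "p * G + g < D * G" .
  then show "(t * (D * G) + (p * G + g)) div (D * G) = t"
    by (intro div_nat_eqI) (simp_all add: algebra_simps)
  have eq: "t * (D * G) + (p * G + g) = (t * D + p) * G + g" by (simp add: algebra_simps)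
  have "(t * (D * G) + (p * G + g)) div G = t * D + p"
    unfolding eq using assms by (intro div_nat_eqI) (simp_all add: algebra_simps)
  then show "(t * (D * G) + (p * G + g)) div G mod D = p" using assms by simp
  show "(t * (D * G) + (p * G + g)) mod G = g"
    unfolding eq using assms by simp
qed

lemma world_bounds:
  assumes "i < D * (D * G)"
  shows "i div (D * G) < D" "i div G mod D < D" "gates ! (i mod G) \<in> gate_set"
proof -
  have "0 < D" using assms by (cases D) auto
  then show "i div G mod D < D" by simp
  show "i div (D * G) < D" using assms by (simp add: less_mult_imp_div_less)
  show "gates ! (i mod G) \<in> gate_set" using G_pos by (metis mod_less_divisor nth_mem set_gates)
qed

lemma world_bound:
  assumes "t < D" "p < D" "g < G"
  shows "t * (D * G) + (p * G + g) < D * (D * G)"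
proof -
  have "p * G + g < Suc p * G" using assms by simp
  also have "\<dots> \<le> D * G" using assms by (intro mult_le_mono1) simp
  finally have "t * (D * G) + (p * G + g) < Suc t * (D * G)" by simp
  also have "\<dots> \<le> D * (D * G)" using assms by (intro mult_le_mono1) simp
  finally show ?thesis .
qed

lemma worlds_model: "worlds (model x D) = {..<D * (D * G)}"
  by (simp add: model_def)

lemma kripke_model_model:
  assumes "0 < D"
  shows "kripke_model (model x D)"
  unfolding kripke_model_def
proof (intro conjI allI)
  have "0 < D * (D * G)" using assms G_pos by simp
  then have "0 \<in> {..<D * (D * G)}" by (rule lessThan_iff[THEN iffD2])
  then show "worlds (model x D) \<noteq> {}" unfolding worlds_model by blast
qed (auto simp: model_def)

lemma sat_model:
  assumes "i < D * (D * G)"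
  shows "sat (model x D) i (nor (4 * D)) \<longleftrightarrow>
    gate_val x (i div (D * G)) (i div G mod D) (gates ! (i mod G))"
proof (rule sat_nor[where W = "{..<D * (D * G)}" and rank = "\<lambda>i. gate_rank (i div (D * G)) (gates ! (i mod G))"])
  show "gate_rank (v div (D * G)) (gates ! (v mod G)) < gate_rank (w div (D * G)) (gates ! (w mod G))"
    if "(w, v) \<in> rel (model x D)" for w v
    using that edge_rank by (auto simp: model_def world_edge_def)
  show "rel (model x D) \<subseteq> {..<D * (D * G)} \<times> {..<D * (D * G)}"
    by (auto simp: model_def)
  have "gate_rank t g < 4 * D" if "t < D" for t g
    using that by (cases g) auto
  then show "gate_rank (i div (D * G)) (gates ! (i mod G)) < 4 * D"
    using world_bounds(1)[OF assms] .
  show "gate_val x (w div (D * G)) (w div G mod D) (gates ! (w mod G)) \<longleftrightarrow>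
    (\<forall>v. (w, v) \<in> rel (model x D) \<longrightarrow> \<not> gate_val x (v div (D * G)) (v div G mod D) (gates ! (v mod G)))"
    if "w \<in> {..<D * (D * G)}" for w
  proof -
    let ?t = "w div (D * G)" and ?p = "w div G mod D" and ?g = "gates ! (w mod G)"
    have w: "w < D * (D * G)" using that by simp
    have "fires x D ?t ?p ?g \<longleftrightarrow>
      (\<exists>v. (w, v) \<in> rel (model x D) \<and> gate_val x (v div (D * G)) (v div G mod D) (gates ! (v mod G)))"
    proof
      assume "fires x D ?t ?p ?g"
      then obtain t' p' g' where f: "t' < D" "p' < D" "g' \<in> gate_set"
        "edge x D ?t ?p ?g t' p' g'" "gate_val x t' p' g'" by (rule firesE)
      \<comment> \<open>A gate may occur repeatedly in \<open>gates\<close>; any of its indices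
        serves.\<close>
      obtain n where n: "n < G" "g' = gates ! n"
        using f(3) by (metis in_set_conv_nth set_gates)
      let ?v = "t' * (D * G) + (p' * G + n)"
      have "(w, ?v) \<in> rel (model x D)" "gate_val x (?v div (D * G)) (?v div G mod D) (gates ! (?v mod G))"
        using w f n world_bound[OF f(1,2) n(1)]
        by (simp_all add: model_def world_edge_def world_decode)
      then show "\<exists>v. (w, v) \<in> rel (model x D) \<and> gate_val x (v div (D * G)) (v div G mod D) (gates ! (v mod G))"
        by blast
    next
      assume "\<exists>v. (w, v) \<in> rel (model x D) \<and> gate_val x (v div (D * G)) (v div G mod D) (gates ! (v mod G))"
      then obtain v where v: "v < D * (D * G)" "world_edge x D w v"
        "gate_val x (v div (D * G)) (v div G mod D) (gates ! (v mod G))" by (auto simp: model_def)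
      then show "fires x D ?t ?p ?g"
        by (intro firesI[OF world_bounds[OF v(1)]]) (simp_all add: world_edge_def)
    qed
    then show ?thesis using gate_val_fires[OF world_bounds[OF w]] by blast
  qed
qed (use assms in simp)

text \<open>The world is the gate \<open>Reject\<close>, number 0, at cell 0 and time
  \<open>D - 1\<close>.\<close>

definition reduction :: "bool list \<Rightarrow> nat \<Rightarrow> bool list" where
  "reduction x D = enc_instance (nor (4 * D)) (model x D) ((D - 1) * (D * G))"

text \<open>Membership only provides some instance with the same string. Injectivity of the encoding
  identifies its formula, world and relation with the constructed ones, and these determine the
  truth of \<open>nor\<close>.\<close>

lemma reduction_correct:
  assumes "tm_decides_in_time M A T" "T (length x) < D"
  shows "x \<in> A \<longleftrightarrow> reduction x D \<in> model_checking strict_imp_varfree"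
proof -
  let ?s = "(D - 1) * (D * G)"
  obtain t where t: "t \<le> T (length x)" "st x t = (if x \<in> A then tm_accept M else tm_reject M)"
    using assms(1) by (auto simp: tm_decides_in_time_def tm_state_after_def st_def config_def)
  \<comment> \<open>Halting states are fixed points of \<open>delta\<close>, so the verdict reached
    before time \<open>D\<close> still stands at time \<open>D - 1\<close>.\<close>
  have "st x (t + n) = st x t" for n
    using t(2) by (induction n) (auto simp: config_Suc next_state_def delta_def)
  from this[of "D - 1 - t"] have "st x (D - 1) = st x t" using t(1) assms(2) by simp
  then have A: "x \<in> A \<longleftrightarrow> st x (D - 1) \<noteq> tm_reject M"
    using t(2) tm by (auto simp: turing_machine_def)
  have D: "0 < D" using assms(2) by simp
  have s: "?s < D * (D * G)" using world_bound[of "D - 1" D 0 0] D G_pos by simp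
  have "sat (model x D) ?s (nor (4 * D)) \<longleftrightarrow> gate_val x (D - 1) 0 Reject"
    using sat_model[OF s] world_decode[of 0 D 0 "D - 1"] D G_pos by (simp add: gates_def)
  with A have sat: "x \<in> A \<longleftrightarrow> sat (model x D) ?s (nor (4 * D))" by simp
  note km = kripke_model_model[OF D, of x] worlds_model[of x D]
  show ?thesis
  proof
    assume "x \<in> A"
    then have "sat (model x D) ?s (nor (4 * D))" using sat by blast
    moreover have "?s \<in> worlds (model x D)" unfolding km(2) using s by (rule lessThan_iff[THEN iffD2])
    ultimately show "reduction x D \<in> model_checking strict_imp_varfree"
      unfolding model_checking_def reduction_def mem_Collect_eq
      by (intro exI conjI) (rule refl nor_strict km | assumption)+
  next
    assume "reduction x D \<in> model_checking strict_imp_varfree"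
    then obtain \<phi> N s n where N: "reduction x D = enc_instance \<phi> N s" "kripke_model N"
      "worlds N = {..<n}" "sat N s \<phi>" unfolding model_checking_def mem_Collect_eq by metis
    have eq: "\<phi> = nor (4 * D)" "s = ?s" "rel N = rel (model x D)"
      using enc_instance_inject[OF km N(2,3) N(1)[unfolded reduction_def]] by simp_all
    have "sat (model x D) ?s (nor (4 * D))"
      using N(4) sat_nor_cong[OF eq(3)] unfolding eq(1,2) by blast
    then show "x \<in> A" using sat by blast
  qed
qed

text \<open>The right side is what loops with bounds \<open>D\<close> and \<open>D - 1\<close> and
  with bodies fixed by the machine print; even \<open>4 * D\<close> and \<open>D * (D * G)\<close>
  appear as repetitions, so no counter has to hold them.\<close>

lemma reduction_eq:
  "reduction x D =
    concat (map (\<lambda>_. concat (replicate 4 [True, True, True, False])) [0..<D]) @ [False, False] @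
    concat (map (\<lambda>_. concat (replicate 4 [False, False])) [0..<D]) @
    concat (map (\<lambda>_. concat (map (\<lambda>_. replicate G True) [0..<D])) [0..<D]) @ [False] @
    concat (map (\<lambda>t. concat (map (\<lambda>p. concat (map (\<lambda>g.
      concat (map (\<lambda>t'. concat (map (\<lambda>p'. map (\<lambda>g'. edge x D t p g t' p' g') gates) [0..<D])) [0..<D]))
        gates)) [0..<D])) [0..<D]) @
    concat (map (\<lambda>_. concat (map (\<lambda>_. replicate G True) [0..<D])) [0..<D - 1]) @ [False]"
proof -
  have rep: "concat (map (\<lambda>_. concat (replicate c xs)) [0..<n]) = concat (replicate (c * n) xs)" for c n and xs :: "bool list"
  proof (induction n)
    case (Suc n)
    have "replicate (c * Suc n) xs = replicate (c * n) xs @ replicate c xs"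
      by (simp add: add.commute flip: replicate_add)
    then show ?case using Suc by simp
  qed simp
  have un: "concat (map (\<lambda>_. concat (map (\<lambda>_. replicate G True) [0..<D])) [0..<m]) = replicate (m * (D * G)) True" for m
  proof -
    have 1: "concat (map (\<lambda>_. replicate a True) [0..<b]) = replicate (b * a) True" for a b
      by (induction b) (simp_all add: add.commute flip: replicate_add)
    show ?thesis unfolding 1 ..
  qed
  have gl: "concat (map F gates) = concat (map (\<lambda>g. F (gates ! g)) [0..<G])" for F :: "gate \<Rightarrow> bool list"
    by (subst map_nth[symmetric, of gates]) (simp only: map_map comp_def)
  have gl2: "map F gates = map (\<lambda>g. F (gates ! g)) [0..<G]" for F :: "gate \<Rightarrow> bool"
    by (subst map_nth[symmetric, of gates]) (simp only: map_map comp_def)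
  have row: "enc_set (D * (D * G)) (rel (model x D) `` {i}) =
      concat (map (\<lambda>t'. concat (map (\<lambda>p'. map (\<lambda>g'. edge x D t p g t' p' g') gates) [0..<D])) [0..<D])"
    if i: "i = t * (D * G) + (p * G + n)" "t < D" "p < D" "n < G" "g = gates ! n" for i t p n g
  proof -
    have "enc_set (D * (D * G)) (rel (model x D) `` {i}) = map (world_edge x D i) [0..<D * (D * G)]"
      using world_bound[OF i(2-4)] i(1) by (auto simp: enc_set_def model_def)
    also have "\<dots> = concat (map (\<lambda>t'. concat (map (\<lambda>p'. map (\<lambda>g'.
        world_edge x D i (t' * (D * G) + (p' * G + g'))) [0..<G]) [0..<D])) [0..<D])"
      by (simp add: map_upt_mult)
    also have "\<dots> = concat (map (\<lambda>t'. concat (map (\<lambda>p'. map (\<lambda>g'. edge x D t p g t' p' g') gates) [0..<D])) [0..<D])"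
      unfolding gl2 using i
      by (intro arg_cong[where f = concat] map_cong refl) (simp add: world_edge_def world_decode)
    finally show ?thesis .
  qed
  have "concat (map (\<lambda>i. enc_set (D * (D * G)) (rel (model x D) `` {i})) [0..<D * (D * G)]) =
    concat (map (\<lambda>t. concat (map (\<lambda>p. concat (map (\<lambda>n. 
       enc_set (D * (D * G)) (rel (model x D) `` {t * (D * G) + (p * G + n)})) [0..<G])) [0..<D])) [0..<D])"
    by (simp add: concat_map_upt_mult)
  also have "\<dots> = concat (map (\<lambda>t. concat (map (\<lambda>p. concat (map (\<lambda>g.
      concat (map (\<lambda>t'. concat (map (\<lambda>p'. map (\<lambda>g'. edge x D t p g t' p' g') gates) [0..<D])) [0..<D]))
        gates)) [0..<D])) [0..<D])"
    unfolding gl[of "\<lambda>g. concat (map (\<lambda>t'. concat (map (\<lambda>p'. map (\<lambda>g'. edge x D t p g t' p' g') gates) [0..<D])) [0..<D])" for t p]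
    by (intro arg_cong[where f = concat] map_cong refl) (rule row; simp)
  finally have mat: "concat (map (\<lambda>i. enc_set (D * (D * G)) (rel (model x D) `` {i})) [0..<D * (D * G)]) = \<dots>" .
  have "card (worlds (model x D)) = D * (D * G)" by (simp add: model_def)
  then show ?thesis
    unfolding reduction_def enc_instance_def Let_def
    by (simp only: mat enc_form_nor rep un var_bound_nor unary_def upt_0 list.map concat.simps append_Nil append.assoc)
qed

end

section \<open>Writing the instance in logarithmic space\<close>

definition assign :: "nat \<Rightarrow> nat \<Rightarrow> com" where
  "assign v w = Zero v ;; Until (Eq v w) (Inc v)"

text \<open>Unrolled when the program is built; meant for lists whose length depends on the machine
  but not on the input.\<close>

definition seqs :: "com list \<Rightarrow> com" where
  "seqs cs = foldr Seq cs Skip"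

definition outs :: "bool list \<Rightarrow> com" where
  "outs bs = seqs (map Out bs)"

text \<open>A conjunction with early exit, each branch of which prints exactly one bit.\<close>

fun emit :: "test list option \<Rightarrow> com" where
  "emit None = Out False"
| "emit (Some bs) = foldr (\<lambda>b c. Cond b c (Out False)) bs (Out True)"

context counter_space
begin

lemma triple_assign:
  assumes v: "v < k" "w < k" "v \<noteq> w"
    and pre: "\<And>\<sigma> i. Pre \<sigma> i \<Longrightarrow> \<sigma> w = n \<and> Post (\<sigma>(v := n)) i"
  shows "triple Pre (assign v w) Post []"
  unfolding assign_def
proof (rule triple_Seq)
  let ?I = "\<lambda>j \<sigma> i. \<sigma> w = n \<and> \<sigma> v = j \<and> Post (\<sigma>(v := n)) i"
  show "triple Pre (Zero v) (?I 0) []"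
    using v pre by (intro triple_Zero) auto
  have "triple (?I 0) (Until (Eq v w) (Inc v)) (?I n) (concat (map (\<lambda>_. []) [0..<n]))"
  proof (rule triple_Until)
    show "triple (\<lambda>\<sigma> i. ?I j \<sigma> i \<and> \<not> holds x (Eq v w) \<sigma> i) (Inc v) (?I (Suc j)) []" if "j < n" for j
      using v that by (intro triple_Inc) (auto simp: in_bounds_def)
  qed (use v in auto)
  then show "triple (?I 0) (Until (Eq v w) (Inc v)) Post []"
    by (rule triple_conseq) (auto dest: fun_upd_idem)
qed simp

lemma triple_seqs:
  assumes "\<And>a. a \<in> set as \<Longrightarrow> triple P (c a) P (out a)"
  shows "triple P (seqs (map c as)) P (concat (map out as))"
  using assms
  by (induction as) (auto simp: seqs_def intro: triple_Skip triple_Seq)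

lemma triple_outs: "triple P (outs bs) P bs"
  using triple_seqs[of bs P Out "\<lambda>b. [b]"] by (simp add: outs_def triple_Out)

lemma triple_emit:
  assumes "\<And>\<sigma> i. P \<sigma> i \<Longrightarrow>
      (case w of None \<Rightarrow> False | Some bs \<Rightarrow> \<forall>b\<in>set bs. holds x b \<sigma> i) = \<beta>"
    and "\<And>bs. w = Some bs \<Longrightarrow> \<forall>b\<in>set bs. test_ok b"
  shows "triple P (emit w) P [\<beta>]"
proof -
  have out: "triple Q (Out b) P [\<beta>]" if "\<And>\<sigma> i. Q \<sigma> i \<Longrightarrow> P \<sigma> i \<and> b = \<beta>" for Q b
  proof (cases "b = \<beta>")
    case True
    then show ?thesis using that by (auto intro: triple_Out)
  next
    \<comment> \<open>The precondition is then contradictory and the triple vacuous.\<close>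
    case False
    then show ?thesis using that by (auto simp: triple_def)
  qed
  \<comment> \<open>The precondition is generalised because \<open>Cond\<close> adds the outcome of
    each test to it.\<close>
  have *: "triple Q (foldr (\<lambda>b c. Cond b c (Out False)) bs (Out True)) P [\<beta>]"
    if "\<forall>b\<in>set bs. test_ok b" "\<And>\<sigma> i. Q \<sigma> i \<Longrightarrow> P \<sigma> i \<and> (\<forall>b\<in>set bs. holds x b \<sigma> i) = \<beta>" for Q bs
    using that
  proof (induction bs arbitrary: Q)
    case Nil
    then show ?case by (auto intro: out)
  next
    case (Cons b bs)
    show ?case
      unfolding foldr.simps comp_apply
    proof (rule triple_Cond)
      show "triple (\<lambda>\<sigma> i. Q \<sigma> i \<and> holds x b \<sigma> i) (foldr (\<lambda>b c. Cond b c (Out False)) bs (Out True)) P [\<beta>]"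
        using Cons.prems by (intro Cons.IH) auto
      show "triple (\<lambda>\<sigma> i. Q \<sigma> i \<and> \<not> holds x b \<sigma> i) (Out False) P [\<beta>]"
        by (rule out) (use Cons.prems(2) in auto)
    qed (use Cons.prems in simp)
  qed
  show ?thesis
    using assms by (cases w) (auto intro: out *)
qed

end

text \<open>Counting the moves from the left to the right end marker gives
  \<open>length x + 1\<close>, positive even for the empty input. The last move puts the head on
  position 1, where the matrix loop expects it.\<close>

definition length_prog :: com where
  "length_prog = Until (In RightEnd) (Mov Rightward ;; Inc vN) ;; Until (In LeftEnd) (Mov Leftward) ;; Mov Rightward"

text \<open>Scratch counter for products; with it the programs use 11 tapes.\<close>

abbreviation (input) "vE \<equiv> 10 :: nat"

definition mult_prog :: com where
  "mult_prog = Zero vE ;; For vT vD (For vP vN (Inc vE)) ;; assign vD vE"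

definition size_prog :: "nat \<Rightarrow> nat \<Rightarrow> com" where
  "size_prog c d = length_prog ;; seqs (map (\<lambda>_. Inc vD) [0..<c]) ;; seqs (map (\<lambda>_. mult_prog) [0..<d])"

context machine
begin

definition formula_prog :: com where
  "formula_prog = For vT vD (outs (concat (replicate 4 [True, True, True, False]))) ;;
     outs [False, False] ;; For vT vD (outs (concat (replicate 4 [False, False])))"

definition plane_prog :: com where
  "plane_prog = For vP vD (outs (replicate G True))"

text \<open>The predecessor of \<open>p'\<close> is never computed: \<open>vL\<close> starts at 0
  and receives the current \<open>p'\<close> at the end of each round, ready for the next
  one.\<close>

definition row_prog :: "gate \<Rightarrow> com" where
  "row_prog g = For vT' vD (assign vS vT' ;; Inc vS ;; Zero vL ;;
     For vP' vD (assign vR vP' ;; Inc vR ;; seqs (map (\<lambda>g'. emit (wire g g')) gates) ;; assign vL vP'))"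

definition matrix_prog :: com where
  "matrix_prog = For vT vD (For vP vD (seqs (map row_prog gates) ;; Mov Rightward))"

text \<open>Without subtraction, \<open>D - 1\<close> rounds are obtained by starting the loop
  counter at 1; as \<open>D\<close> is positive, the exit is reached.\<close>

definition world_prog :: com where
  "world_prog = Zero vT ;; Inc vT ;; Until (Eq vT vD) (plane_prog ;; Inc vT) ;; Out False"

definition prog :: "nat \<Rightarrow> nat \<Rightarrow> com" where
  "prog c d = size_prog c d ;; formula_prog ;; (For vT vD plane_prog ;; Out False) ;; matrix_prog ;; world_prog"

end

text \<open>Every position beyond the input reads as \<open>RightEnd\<close>, so a head held at the
  marker sees the same as one that walks on; this end marker plays the part of the blank cells of
  the initial tape.\<close>

lemma in_read_min: "in_read x (min m (Suc (length x))) = in_read x m"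
  by (auto simp: in_read_def min_def)

section \<open>Computing the side length of the tableau\<close>

locale size_space = counter_space 11 x B for x :: "bool list" and B :: nat
begin

lemma triple_length_prog:
  assumes "Suc (length x) \<le> B"
  shows "triple (\<lambda>\<sigma> i. \<sigma> = (\<lambda>_. 0) \<and> i = 0) length_prog
    (\<lambda>\<sigma> i. \<sigma> vZ = 0 \<and> \<sigma> vD = 0 \<and> \<sigma> vN = Suc (length x) \<and> i = 1) []"
  unfolding length_prog_def
proof (intro triple_Seq)
  let ?I = "\<lambda>j \<sigma> i. \<sigma> vZ = 0 \<and> \<sigma> vD = 0 \<and> \<sigma> vN = j \<and> i = j"
  have "triple (?I 0) (Until (In RightEnd) (Mov Rightward ;; Inc vN)) (?I (Suc (length x)))
     (concat (map (\<lambda>_. []) [0..<Suc (length x)]))"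
  proof (rule triple_Until)
    show "triple (\<lambda>\<sigma> i. ?I j \<sigma> i \<and> \<not> holds x (In RightEnd) \<sigma> i) (Mov Rightward ;; Inc vN) (?I (Suc j)) []"
      if "j < Suc (length x)" for j
      using that assms
      by (intro triple_Seq[where outc = "[]" and outd = "[]" and
            Mid = "\<lambda>\<sigma> i. \<sigma> vZ = 0 \<and> \<sigma> vD = 0 \<and> \<sigma> vN = j \<and> i = Suc j"] triple_Mov triple_Inc) auto
  qed (auto simp: in_read_def)
  then show "triple (\<lambda>\<sigma> i. \<sigma> = (\<lambda>_. 0) \<and> i = 0) (Until (In RightEnd) (Mov Rightward ;; Inc vN))
      (?I (Suc (length x))) []"
    by (rule triple_conseq) auto
  let ?J = "\<lambda>j \<sigma> i. \<sigma> vZ = 0 \<and> \<sigma> vD = 0 \<and> \<sigma> vN = Suc (length x) \<and> i = Suc (length x) - j"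
  have "triple (?J 0) (Until (In LeftEnd) (Mov Leftward)) (?J (Suc (length x)))
     (concat (map (\<lambda>_. []) [0..<Suc (length x)]))"
  proof (rule triple_Until)
    show "triple (\<lambda>\<sigma> i. ?J j \<sigma> i \<and> \<not> holds x (In LeftEnd) \<sigma> i) (Mov Leftward) (?J (Suc j)) []"
      if "j < Suc (length x)" for j
      by (intro triple_Mov) auto
  qed (auto simp: in_read_def)
  then show "triple (?I (Suc (length x))) (Until (In LeftEnd) (Mov Leftward)) (?J (Suc (length x))) []"
    by (rule triple_conseq) auto
  show "triple (?J (Suc (length x))) (Mov Rightward)
     (\<lambda>\<sigma> i. \<sigma> vZ = 0 \<and> \<sigma> vD = 0 \<and> \<sigma> vN = Suc (length x) \<and> i = 1) []"
    by (intro triple_Mov) auto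
qed simp_all

lemma triple_mult_prog:
  assumes "m * n \<le> B" "m \<le> B" "n \<le> B"
  shows "triple (\<lambda>\<sigma> i. \<sigma> vZ = 0 \<and> \<sigma> vN = n \<and> i = 1 \<and> \<sigma> vD = m) mult_prog
    (\<lambda>\<sigma> i. \<sigma> vZ = 0 \<and> \<sigma> vN = n \<and> i = 1 \<and> \<sigma> vD = m * n) []"
  unfolding mult_prog_def
proof (intro triple_Seq)
  let ?I = "\<lambda>j \<sigma> i. \<sigma> vZ = 0 \<and> \<sigma> vN = n \<and> i = 1 \<and> \<sigma> vE = j * n"
  let ?J = "\<lambda>j a \<sigma> i. \<sigma> vZ = 0 \<and> \<sigma> vD = m \<and> \<sigma> vT = j \<and> i = 1 \<and> \<sigma> vE = j * n + a"
  show "triple (\<lambda>\<sigma> i. \<sigma> vZ = 0 \<and> \<sigma> vN = n \<and> i = 1 \<and> \<sigma> vD = m) (Zero vE) (\<lambda>\<sigma> i. ?I 0 \<sigma> i \<and> \<sigma> vD = m) []"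
    by (intro triple_Zero) auto
  have "triple (\<lambda>\<sigma> i. ?I 0 \<sigma> i \<and> \<sigma> vD = m) (For vT vD (For vP vN (Inc vE))) (\<lambda>\<sigma> i. ?I m \<sigma> i \<and> \<sigma> vD = m)
     (concat (map (\<lambda>_. []) [0..<m]))"
  proof (rule triple_For)
    fix j assume j: "j < m"
    have "triple (\<lambda>\<sigma> i. ?J j 0 \<sigma> i \<and> \<sigma> vN = n) (For vP vN (Inc vE)) (\<lambda>\<sigma> i. ?J j n \<sigma> i \<and> \<sigma> vN = n)
       (concat (map (\<lambda>_. []) [0..<n]))"
    proof (rule triple_For)
      fix a assume "a < n"
      then have "j * n + a < Suc j * n" by simp
      also have "\<dots> \<le> m * n" using j by (intro mult_le_mono1) simp
      finally have "j * n + a < B" using assms by simp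
      then show "triple (\<lambda>\<sigma> i. ?J j a \<sigma> i \<and> \<sigma> vP = a \<and> \<sigma> vN = n) (Inc vE)
         (\<lambda>\<sigma> i. ?J j (Suc a) \<sigma> i \<and> \<sigma> vP = a \<and> \<sigma> vN = n) []"
        by (intro triple_Inc) auto
    qed (use assms in auto)
    then show "triple (\<lambda>\<sigma> i. ?I j \<sigma> i \<and> \<sigma> vT = j \<and> \<sigma> vD = m) (For vP vN (Inc vE))
       (\<lambda>\<sigma> i. ?I (Suc j) \<sigma> i \<and> \<sigma> vT = j \<and> \<sigma> vD = m) []"
      by (rule triple_conseq) auto
  qed (use assms in auto)
  then show "triple (\<lambda>\<sigma> i. ?I 0 \<sigma> i \<and> \<sigma> vD = m) (For vT vD (For vP vN (Inc vE))) (\<lambda>\<sigma> i. ?I m \<sigma> i \<and> \<sigma> vD = m) []"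
    by (rule triple_conseq) auto
  show "triple (\<lambda>\<sigma> i. ?I m \<sigma> i \<and> \<sigma> vD = m) (assign vD vE)
    (\<lambda>\<sigma> i. \<sigma> vZ = 0 \<and> \<sigma> vN = n \<and> i = 1 \<and> \<sigma> vD = m * n) []"
    by (rule triple_assign[where n = "m * n"]) auto
qed simp_all

lemma triple_iterate:
  assumes "\<And>j. j < n \<Longrightarrow> triple (I j) c (I (Suc j)) []"
  shows "triple (I 0) (seqs (map (\<lambda>_. c) [0..<n])) (I n) []"
proof -
  \<comment> \<open>Induction on the number \<open>j\<close> of copies still to run, since
    \<open>seqs\<close> peels off the front one.\<close>
  have "triple (I (n - j)) (seqs (map (\<lambda>_. c) [0..<j])) (I n) []" if "j \<le> n" for j
    using that
  proof (induction j)
    case 0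
    show ?case by (auto simp: seqs_def intro: triple_Skip)
  next
    case (Suc j)
    have "map (\<lambda>_. c) [0..<Suc j] = c # map (\<lambda>_. c) [0..<j]"
      by (metis map_replicate_const length_upt diff_zero replicate_Suc)
    moreover have "triple (I (n - Suc j)) c (I (n - j)) []"
      using assms[of "n - Suc j"] Suc.prems by (simp add: Suc_diff_Suc)
    ultimately show ?case
      using Suc by (auto simp: seqs_def intro: triple_Seq[where outc = "[]" and outd = "[]"])
  qed
  from this[of n] show ?thesis by simp
qed

lemma triple_size_prog:
  assumes B: "c * Suc (length x) ^ d \<le> B" "Suc (length x) \<le> B" and c: "0 < c"
  shows "triple (\<lambda>\<sigma> i. \<sigma> = (\<lambda>_. 0) \<and> i = 0) (size_prog c d)
    (\<lambda>\<sigma> i. \<sigma> vZ = 0 \<and> i = 1 \<and> \<sigma> vD = c * Suc (length x) ^ d) []"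
  unfolding size_prog_def
proof (rule triple_Seq[OF triple_length_prog[OF B(2)] triple_Seq])
  let ?n = "Suc (length x)"
  let ?I = "\<lambda>m \<sigma> i. \<sigma> vZ = 0 \<and> \<sigma> vN = ?n \<and> i = 1 \<and> \<sigma> vD = m"
  \<comment> \<open>Intermediate powers stay below the final one as the base is at least 1.\<close>
  have le: "c * ?n ^ j \<le> B" if "j \<le> d" for j
    by (rule order_trans[OF mult_le_mono2[OF power_increasing[OF that]] B(1)]) simp
  have "triple (?I j) (Inc vD) (?I (Suc j)) []" if "j < c" for j
    using that le[of 0] by (intro triple_Inc) auto
  from triple_iterate[of c ?I, OF this]
  show "triple (\<lambda>\<sigma> i. \<sigma> vZ = 0 \<and> \<sigma> vD = 0 \<and> \<sigma> vN = Suc (length x) \<and> i = 1)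
      (seqs (map (\<lambda>_. Inc vD) [0..<c])) (?I c) []"
    by (rule triple_conseq) auto
  have "triple (?I (c * ?n ^ j)) mult_prog (?I (c * ?n ^ Suc j)) []" if "j < d" for j
    using triple_mult_prog[of "c * ?n ^ j" ?n] le[of j] le[of "Suc j"] that B(2)
    by (simp add: ac_simps)
  from triple_iterate[of d "\<lambda>j. ?I (c * ?n ^ j)", OF this]
  show "triple (?I c) (seqs (map (\<lambda>_. mult_prog) [0..<d])) (\<lambda>\<sigma> i. \<sigma> vZ = 0 \<and> i = 1 \<and> \<sigma> vD = c * ?n ^ d) []"
    by (rule triple_conseq) auto
qed simp_all

end

section \<open>Printing the instance\<close>

locale emitter = size_space x B + machine M for x B M +
  fixes D :: nat
  assumes DB: "D \<le> B" and D_pos: "0 < D"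
begin

text \<open>The bracketing matches \<open>I j \<sigma> i \<and> \<sigma> w = n\<close> in
  \<open>triple_For\<close>, with \<open>vD\<close> as the bound of the loop.\<close>

abbreviation "start_state \<equiv> (\<lambda>\<sigma> i. (\<sigma> vZ = (0::nat) \<and> i = (1::nat)) \<and> \<sigma> vD = D)"

lemma triple_formula_prog:
  "triple start_state formula_prog start_state
    (concat (map (\<lambda>_. concat (replicate 4 [True, True, True, False])) [0..<D]) @ [False, False] @
     concat (map (\<lambda>_. concat (replicate 4 [False, False])) [0..<D]))"
  unfolding formula_prog_def
  by (rule triple_Seq[OF triple_For triple_Seq[OF triple_outs triple_For refl] refl]; (rule triple_outs)?)
     (use DB in auto)

lemma triple_plane_prog:
  "triple (\<lambda>\<sigma> i. (\<sigma> vZ = 0 \<and> i = m \<and> \<sigma> vT = t) \<and> \<sigma> vD = D) plane_prog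
    (\<lambda>\<sigma> i. (\<sigma> vZ = 0 \<and> i = m \<and> \<sigma> vT = t) \<and> \<sigma> vD = D) (concat (map (\<lambda>_. replicate G True) [0..<D]))"
  unfolding plane_prog_def
  by (rule triple_For; (rule triple_outs)?) (use DB in auto)

lemma triple_size_unary:
  "triple start_state (For vT vD plane_prog ;; Out False) start_state
    (concat (map (\<lambda>_. concat (map (\<lambda>_. replicate G True) [0..<D])) [0..<D]) @ [False])"
proof (rule triple_Seq)
  show "triple start_state (For vT vD plane_prog) start_state
    (concat (map (\<lambda>_. concat (map (\<lambda>_. replicate G True) [0..<D])) [0..<D]))"
  proof (rule triple_For)
    show "triple (\<lambda>\<sigma> i. (\<sigma> vZ = 0 \<and> i = 1) \<and> \<sigma> vT = j \<and> \<sigma> vD = D) plane_prog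
        (\<lambda>\<sigma> i. (\<sigma> vZ = 0 \<and> i = 1) \<and> \<sigma> vT = j \<and> \<sigma> vD = D)
        (concat (map (\<lambda>_. replicate G True) [0..<D]))" for j
      using triple_plane_prog[of 1 j] by (rule triple_conseq) auto
  qed (use DB in auto)
qed (auto intro: triple_Out)

lemma triple_world_prog:
  "triple (\<lambda>\<sigma> i. \<sigma> vZ = 0 \<and> \<sigma> vD = D) world_prog (\<lambda>\<sigma> i. True)
    (concat (map (\<lambda>_. concat (map (\<lambda>_. replicate G True) [0..<D])) [0..<D - 1]) @ [False])"
  unfolding world_prog_def
proof (rule triple_Seq[OF _ triple_Seq[OF _ triple_Seq]])
  let ?I = "\<lambda>j \<sigma> i. \<sigma> vZ = 0 \<and> \<sigma> vD = D \<and> \<sigma> vT = Suc j"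
  show "triple (\<lambda>\<sigma> i. \<sigma> vZ = 0 \<and> \<sigma> vD = D) (Zero vT) (\<lambda>\<sigma> i. \<sigma> vZ = 0 \<and> \<sigma> vD = D \<and> \<sigma> vT = 0) []"
    by (intro triple_Zero) auto
  show "triple (\<lambda>\<sigma> i. \<sigma> vZ = 0 \<and> \<sigma> vD = D \<and> \<sigma> vT = 0) (Inc vT) (?I 0) []"
    using DB D_pos by (intro triple_Inc) auto
  show "triple (?I 0) (Until (Eq vT vD) (plane_prog ;; Inc vT)) (?I (D - 1))
      (concat (map (\<lambda>_. concat (map (\<lambda>_. replicate G True) [0..<D])) [0..<D - 1]))"
  proof (rule triple_Until)
    fix j assume j: "j < D - 1"
    let ?J = "\<lambda>\<sigma> i. (\<sigma> vZ = 0 \<and> \<sigma> vT = Suc j) \<and> \<sigma> vD = D"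
    have "triple ?J plane_prog ?J (concat (map (\<lambda>_. replicate G True) [0..<D]))"
      unfolding plane_prog_def by (rule triple_For; (rule triple_outs)?) (use DB in auto)
    moreover have "triple ?J (Inc vT) (?I (Suc j)) []"
      using j DB by (intro triple_Inc) auto
    ultimately have "triple ?J (plane_prog ;; Inc vT) (?I (Suc j)) (concat (map (\<lambda>_. replicate G True) [0..<D]))"
      by (rule triple_Seq) simp
    then show "triple (\<lambda>\<sigma> i. ?I j \<sigma> i \<and> \<not> holds x (Eq vT vD) \<sigma> i) (plane_prog ;; Inc vT) (?I (Suc j))
        (concat (map (\<lambda>_. replicate G True) [0..<D]))"
      by (rule triple_conseq) auto
  qed (use D_pos in auto)
qed (auto intro: triple_Out)

definition wire_vars :: "nat set" where
  "wire_vars = {vZ, vT, vP, vT', vP', vS, vL, vR}"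

text \<open>Wires compare \<open>vP\<close> with \<open>dir_var d\<close>, and
  \<open>test_ok\<close> demands distinct counters.\<close>

lemma dir_var_wire_vars: "dir_var d \<in> wire_vars" "dir_var d \<noteq> vP"
  by (cases d; simp add: wire_vars_def)+

lemma wire_tests:
  assumes "wire g g' = Some bs" "b \<in> set bs"
  shows "case b of Eq u v \<Rightarrow> u \<in> wire_vars \<and> v \<in> wire_vars \<and> u \<noteq> v | In s \<Rightarrow> True"
proof -
  have "vZ \<in> wire_vars" "vT \<in> wire_vars" "vP \<in> wire_vars" "vT' \<in> wire_vars" "vP' \<in> wire_vars" "vS \<in> wire_vars"
    by (simp_all add: wire_vars_def)
  then show ?thesis
    using assms dir_var_wire_vars
    by (cases "(g, g')" rule: wire.cases) (auto split: if_splits symbol.splits)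
qed

lemma wire_tests_ok:
  assumes "wire g g' = Some bs" "b \<in> set bs"
  shows "test_ok b"
proof -
  have "v < 11" if "v \<in> wire_vars" for v using that by (auto simp: wire_vars_def)
  then show ?thesis using wire_tests[OF assms] by (cases b) auto
qed

text \<open>\<open>edge\<close> refers to ideal counters and an unbounded input head. The transducer
  agrees on all counters that wires mention, and stopping at the right end marker does not change
  what is read.\<close>

lemma wire_holds:
  assumes "\<sigma> vZ = 0" "\<sigma> vT = t" "\<sigma> vP = p" "\<sigma> vT' = t'" "\<sigma> vP' = p'" "\<sigma> vS = Suc t'"
    "\<sigma> vL = p' - 1" "\<sigma> vR = Suc p'" "i = min (Suc (t * D + p)) (Suc (length x))"
  shows "(case wire g g' of None \<Rightarrow> False | Some bs \<Rightarrow> \<forall>b\<in>set bs. holds x b \<sigma> i) = edge x D t p g t' p' g'"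
proof -
  have \<sigma>: "\<sigma> v = env t p t' p' v" if "v \<in> wire_vars" for v
    using that assms(1-8) by (auto simp: env_def wire_vars_def)
  have "holds x b \<sigma> i = holds x b (env t p t' p') (Suc (t * D + p))"
    if w: "wire g g' = Some bs" "b \<in> set bs" for b bs
  proof -
    show ?thesis
    proof (cases b)
      case (Eq u v)
      then show ?thesis using wire_tests[OF w] \<sigma> by simp
    next
      case (In s)
      show ?thesis unfolding In holds.simps assms(9) in_read_min ..
    qed
  qed
  then show ?thesis by (auto simp: edge_def split: option.split)
qed

lemma triple_row_prog:
  assumes "t < D" "p < D"
  defines "h \<equiv> min (Suc (t * D + p)) (Suc (length x))"
  shows "triple (\<lambda>\<sigma> i. (\<sigma> vZ = 0 \<and> \<sigma> vT = t \<and> \<sigma> vP = p \<and> i = h) \<and> \<sigma> vD = D) (row_prog g)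
    (\<lambda>\<sigma> i. (\<sigma> vZ = 0 \<and> \<sigma> vT = t \<and> \<sigma> vP = p \<and> i = h) \<and> \<sigma> vD = D)
    (concat (map (\<lambda>t'. concat (map (\<lambda>p'. map (\<lambda>g'. edge x D t p g t' p' g') gates) [0..<D])) [0..<D]))"
  unfolding row_prog_def
proof (rule triple_For)
  fix t' assume t': "t' < D"
  let ?A = "\<lambda>\<sigma> i. (\<sigma> vZ = 0 \<and> \<sigma> vT = t \<and> \<sigma> vP = p \<and> i = h) \<and> \<sigma> vT' = t' \<and> \<sigma> vD = D"
  \<comment> \<open>Truncated subtraction makes 0 the right value of \<open>vL\<close> both for
    \<open>p' = 0\<close> and for \<open>p' = 1\<close>.\<close>
  let ?Q = "\<lambda>p' \<sigma> i. \<sigma> vZ = 0 \<and> \<sigma> vT = t \<and> \<sigma> vP = p \<and> i = h \<and> \<sigma> vT' = t' \<and> \<sigma> vS = Suc t' \<and> \<sigma> vL = p' - 1"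
  let ?body = "\<lambda>p'. map (\<lambda>g'. edge x D t p g t' p' g') gates"
  let ?loop = "assign vR vP' ;; Inc vR ;; seqs (map (\<lambda>g'. emit (wire g g')) gates) ;; assign vL vP'"
  show "triple ?A (assign vS vT' ;; Inc vS ;; Zero vL ;; For vP' vD ?loop) ?A (concat (map ?body [0..<D]))"
  proof (rule triple_Seq[OF _ triple_Seq[OF _ triple_Seq]])
    show "triple ?A (assign vS vT') (\<lambda>\<sigma> i. ?A \<sigma> i \<and> \<sigma> vS = t') []"
      by (rule triple_assign[where n = t']) auto
    show "triple (\<lambda>\<sigma> i. ?A \<sigma> i \<and> \<sigma> vS = t') (Inc vS) (\<lambda>\<sigma> i. ?A \<sigma> i \<and> \<sigma> vS = Suc t') []"
      using DB t' by (intro triple_Inc) auto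
    show "triple (\<lambda>\<sigma> i. ?A \<sigma> i \<and> \<sigma> vS = Suc t') (Zero vL) (\<lambda>\<sigma> i. ?Q 0 \<sigma> i \<and> \<sigma> vD = D) []"
      by (intro triple_Zero) auto
    have "triple (\<lambda>\<sigma> i. ?Q 0 \<sigma> i \<and> \<sigma> vD = D) (For vP' vD ?loop) (\<lambda>\<sigma> i. ?Q D \<sigma> i \<and> \<sigma> vD = D)
      (concat (map ?body [0..<D]))"
    proof (rule triple_For)
      fix p' assume p': "p' < D"
      let ?R = "\<lambda>\<sigma> i. ?Q p' \<sigma> i \<and> \<sigma> vP' = p' \<and> \<sigma> vD = D"
      show "triple ?R ?loop (\<lambda>\<sigma> i. ?Q (Suc p') \<sigma> i \<and> \<sigma> vP' = p' \<and> \<sigma> vD = D) (?body p')"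
      proof (rule triple_Seq[OF _ triple_Seq[OF _ triple_Seq]])
        show "triple ?R (assign vR vP') (\<lambda>\<sigma> i. ?R \<sigma> i \<and> \<sigma> vR = p') []"
          by (rule triple_assign[where n = p']) auto
        show "triple (\<lambda>\<sigma> i. ?R \<sigma> i \<and> \<sigma> vR = p') (Inc vR) (\<lambda>\<sigma> i. ?R \<sigma> i \<and> \<sigma> vR = Suc p') []"
          using DB p' by (intro triple_Inc) auto
        show "triple (\<lambda>\<sigma> i. ?R \<sigma> i \<and> \<sigma> vR = Suc p') (seqs (map (\<lambda>g'. emit (wire g g')) gates))
           (\<lambda>\<sigma> i. ?R \<sigma> i \<and> \<sigma> vR = Suc p') (concat (map (\<lambda>g'. [edge x D t p g t' p' g']) gates))"
        proof (rule triple_seqs, rule triple_emit)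
          show "(case wire g g' of None \<Rightarrow> False | Some bs \<Rightarrow> \<forall>b\<in>set bs. holds x b \<sigma> i) = edge x D t p g t' p' g'"
            if "?R \<sigma> i \<and> \<sigma> vR = Suc p'" for g' \<sigma> i
            using that by (intro wire_holds) (auto simp: h_def)
        qed (use wire_tests_ok in blast)
        show "triple (\<lambda>\<sigma> i. ?R \<sigma> i \<and> \<sigma> vR = Suc p') (assign vL vP')
           (\<lambda>\<sigma> i. ?Q (Suc p') \<sigma> i \<and> \<sigma> vP' = p' \<and> \<sigma> vD = D) []"
          by (rule triple_assign[where n = p']) auto
      qed simp_all
    qed (use DB in auto)
    then show "triple (\<lambda>\<sigma> i. ?Q 0 \<sigma> i \<and> \<sigma> vD = D) (For vP' vD ?loop) ?A (concat (map ?body [0..<D]))"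
      by (rule triple_conseq) auto
  qed simp_all
qed (use DB in auto)

lemma triple_matrix_prog:
  "triple start_state matrix_prog (\<lambda>\<sigma> i. \<sigma> vZ = 0 \<and> \<sigma> vD = D)
    (concat (map (\<lambda>t. concat (map (\<lambda>p. concat (map (\<lambda>g.
      concat (map (\<lambda>t'. concat (map (\<lambda>p'. map (\<lambda>g'. edge x D t p g t' p' g') gates) [0..<D])) [0..<D]))
        gates)) [0..<D])) [0..<D]))"
proof -
  let ?h = "\<lambda>t p. min (Suc (t * D + p)) (Suc (length x))"
  let ?row = "\<lambda>t p g. concat (map (\<lambda>t'. concat (map (\<lambda>p'. map (\<lambda>g'. edge x D t p g t' p' g') gates) [0..<D])) [0..<D])"
  let ?I = "\<lambda>t \<sigma> i. \<sigma> vZ = 0 \<and> i = ?h t 0"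
  have "triple (\<lambda>\<sigma> i. ?I 0 \<sigma> i \<and> \<sigma> vD = D) matrix_prog (\<lambda>\<sigma> i. ?I D \<sigma> i \<and> \<sigma> vD = D)
    (concat (map (\<lambda>t. concat (map (\<lambda>p. concat (map (?row t p) gates)) [0..<D])) [0..<D]))"
    unfolding matrix_prog_def
  proof (rule triple_For)
    fix t assume t: "t < D"
    let ?J = "\<lambda>p \<sigma> i. \<sigma> vZ = 0 \<and> \<sigma> vT = t \<and> i = ?h t p"
    have "triple (\<lambda>\<sigma> i. ?J 0 \<sigma> i \<and> \<sigma> vD = D) (For vP vD (seqs (map row_prog gates) ;; Mov Rightward))
       (\<lambda>\<sigma> i. ?J D \<sigma> i \<and> \<sigma> vD = D) (concat (map (\<lambda>p. concat (map (?row t p) gates)) [0..<D]))"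
    proof (rule triple_For)
      fix p assume p: "p < D"
      let ?K = "\<lambda>\<sigma> i. (\<sigma> vZ = 0 \<and> \<sigma> vT = t \<and> \<sigma> vP = p \<and> i = ?h t p) \<and> \<sigma> vD = D"
      have "triple ?K (seqs (map row_prog gates)) ?K (concat (map (?row t p) gates))"
        by (rule triple_seqs) (rule triple_row_prog[OF t p])
      moreover have "triple ?K (Mov Rightward) (\<lambda>\<sigma> i. ?J (Suc p) \<sigma> i \<and> \<sigma> vP = p \<and> \<sigma> vD = D) []"
        by (rule triple_Mov) auto
      ultimately have "triple ?K (seqs (map row_prog gates) ;; Mov Rightward)
         (\<lambda>\<sigma> i. ?J (Suc p) \<sigma> i \<and> \<sigma> vP = p \<and> \<sigma> vD = D) (concat (map (?row t p) gates))"
        by (rule triple_Seq) simp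
      then show "triple (\<lambda>\<sigma> i. ?J p \<sigma> i \<and> \<sigma> vP = p \<and> \<sigma> vD = D) (seqs (map row_prog gates) ;; Mov Rightward)
         (\<lambda>\<sigma> i. ?J (Suc p) \<sigma> i \<and> \<sigma> vP = p \<and> \<sigma> vD = D) (concat (map (?row t p) gates))"
        by (rule triple_conseq) auto
    qed (use DB in auto)
    \<comment> \<open>The head position after the last cell at time \<open>t\<close> is that of cell
      0 at time \<open>t + 1\<close>, so no rewinding occurs between time steps.\<close>
    then show "triple (\<lambda>\<sigma> i. ?I t \<sigma> i \<and> \<sigma> vT = t \<and> \<sigma> vD = D) (For vP vD (seqs (map row_prog gates) ;; Mov Rightward))
       (\<lambda>\<sigma> i. ?I (Suc t) \<sigma> i \<and> \<sigma> vT = t \<and> \<sigma> vD = D) (concat (map (\<lambda>p. concat (map (?row t p) gates)) [0..<D]))"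
      by (rule triple_conseq) (auto simp: add.commute)
  qed (use DB in auto)
  then show ?thesis by (rule triple_conseq) auto
qed

lemma triple_prog:
  assumes D: "D = c * Suc (length x) ^ d" and c: "0 < c" and B: "Suc (length x) \<le> B"
  shows "triple (\<lambda>\<sigma> i. \<sigma> = (\<lambda>_. 0) \<and> i = 0) (prog c d) (\<lambda>\<sigma> i. True) (reduction x D)"
  unfolding prog_def
proof (rule triple_Seq)
  show "triple (\<lambda>\<sigma> i. \<sigma> = (\<lambda>_. 0) \<and> i = 0) (size_prog c d) start_state []"
    using triple_size_prog[OF _ B c, of d] DB unfolding D by (auto elim: triple_conseq)
  show "triple start_state (formula_prog ;; (For vT vD plane_prog ;; Out False) ;; matrix_prog ;; world_prog)
     (\<lambda>\<sigma> i. True) (reduction x D)"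
    by (rule triple_Seq[OF triple_formula_prog triple_Seq[OF triple_size_unary
          triple_Seq[OF triple_matrix_prog triple_world_prog refl] refl]])
       (simp add: reduction_eq)
qed simp

end

text \<open>Such a bound is fixed by two constants that \<open>size_prog\<close> can unroll; n + 1
  in place of n keeps it positive at 0. Strictness ensures that the machine has stopped by time
  \<open>D - 1\<close>.\<close>

lemma poly_nat_less_monomial:
  fixes p :: "nat poly"
  shows "\<exists>c d. 0 < c \<and> (\<forall>n. poly p n < c * Suc n ^ d)"
proof (induction p)
  case 0
  show ?case by (intro exI[of _ 1] exI[of _ 0]) simp
next
  case (pCons a p)
  then obtain c d where IH: "\<And>n. poly p n < c * Suc n ^ d" by auto
  \<comment> \<open>\<open>a\<close> covers the constant term, \<open>c\<close> the product with the
    variable, and 1 the strict inequality.\<close>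
  have "poly (pCons a p) n < (a + 1 + c) * Suc n ^ Suc d" for n
  proof -
    define y where "y = Suc n ^ Suc d"
    have y: "0 < y" by (simp add: y_def)
    then have "a \<le> a * y" by simp
    moreover have "n * poly p n \<le> Suc n * (c * Suc n ^ d)"
      using IH[of n] by (intro mult_le_mono) simp_all
    then have "n * poly p n \<le> c * y" by (simp add: y_def ac_simps)
    moreover have "(a + 1 + c) * y = a * y + y + c * y" by (simp add: algebra_simps)
    ultimately have "a + n * poly p n < (a + 1 + c) * y" using y by linarith
    moreover have "poly (pCons a p) n = a + n * poly p n" by simp
    ultimately show ?thesis by (simp only: y_def)
  qed
  then show ?case by (intro exI[of _ "a + 1 + c"] exI[of _ "Suc d"] conjI allI) simp_all
qed

theorem theorem2p5:
  shows "P_hard (model_checking strict_imp_varfree)"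
  unfolding P_hard_def
proof
  fix A assume "A \<in> PTIME"
  then obtain M and p :: "nat poly" where M: "turing_machine M" "tm_decides_in_time M A (poly p)"
    by (auto simp: PTIME_def)
  interpret machine M by unfold_locales (rule M(1))
  obtain c d where c: "0 < c" and less: "\<And>n. poly p n < c * Suc n ^ d"
    using poly_nat_less_monomial[of p] by blast
  define D where "D x = c * Suc (length x) ^ d" for x :: "bool list"
  have "logspace_computable (\<lambda>x. reduction x (D x))"
  \<comment> \<open>The bound has one factor more than \<open>D\<close>, so that the counter holding
    \<open>length x + 1\<close> fits even if \<open>d = 0\<close>. The exponent comes from
    \<open>c \<le> n ^ c\<close> and \<open>n + 1 \<le> n ^ 2\<close>, both valid from
    \<open>n = 2\<close> on.\<close>
  proof (rule logspace_computableI[where bound = "\<lambda>n. c * Suc n ^ Suc d" and d = "c + 2 * Suc d"])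
    fix x :: "bool list"
    have "1 * Suc (length x) \<le> (c * Suc (length x) ^ d) * Suc (length x)"
      using c by (intro mult_le_mono1) (simp add: Suc_le_eq)
    then have B: "Suc (length x) \<le> c * Suc (length x) ^ Suc d" by (simp add: ac_simps)
    interpret emitter x "c * Suc (length x) ^ Suc d" M "D x"
      by unfold_locales (use c in \<open>simp_all add: D_def\<close>)
    show "triple (\<lambda>\<sigma> i. \<sigma> = (\<lambda>_. 0) \<and> i = 0) (prog c d) (\<lambda>\<sigma> i. True) (reduction x (D x))"
      using D_def c B by (rule triple_prog)
  next
    fix n :: nat assume n: "2 \<le> n"
    have "c \<le> n ^ c"
      using less_exp[of c] power_mono[OF n, of c] by linarith
    moreover have "Suc n \<le> n ^ 2"
      using mult_le_mono1[OF n, of n] n unfolding power2_eq_square by linarith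
    then have "Suc n ^ Suc d \<le> (n ^ 2) ^ Suc d" by (rule power_mono) simp
    ultimately show "c * Suc n ^ Suc d \<le> n ^ (c + 2 * Suc d)"
      unfolding power_add power_mult by (rule mult_le_mono)
  qed (use c in simp)
  moreover have "x \<in> A \<longleftrightarrow> reduction x (D x) \<in> model_checking strict_imp_varfree" for x
    using reduction_correct[OF M(2)] less by (simp add: D_def)
  ultimately show "logspace_reducible A (model_checking strict_imp_varfree)"
    unfolding logspace_reducible_def by (intro exI[of _ "\<lambda>x. reduction x (D x)"] conjI allI)
qed

end
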